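(* There exist two absolute constants $c_1,c_2>0$ such that for every $n\geq 2$ and for every centered convex body $K$ in $\mathbb{R}^n$, $$\frac{c_1 n^{3/2}}{\mathrm{ovr}(\mathrm{conv}(K,-K))}\leq \mathrm{vi}(K)\leq c_2 n^2.$$
   Context: A convex body in $\mathbb{R}^n$ is a compact convex subset of $\mathbb{R}^n$ with non-empty interior; $|\cdot|$ denotes $n$-dimensional volume. A convex body $K$ is centered if its center of mass $\frac{1}{|K|}\int_K x\,dx$ is the origin. For such $K$ (then $0\in\mathrm{int}(K)$), the Minkowski functional of $K$ is $p_K(x)=\inf\{t>0: x\in tK\}$, and the (generalized) vertex index of a centered convex body $K$ is $$\mathrm{vi}(K)=\inf\Big\{\sum_{j=1}^N p_K(y_j): K\subseteq \mathrm{conv}(\{y_1,\ldots,y_N\})\Big\},$$ where the infimum is over all positive integers $N$ and all $y_1,\ldots,y_N\in\mathbb{R}^n$ with the stated inclusion. $\mathrm{conv}(K,-K)$ denotes the convex hull of $K\cup(-K)$. The outer volume ratio of a convex body $L$ in $\mathbb{R}^n$ is $$\mathrm{ovr}(L)=\inf\Big\{\Big(\frac{|\mathcal{E}|}{|L|}\Big)^{1/n}: \mathcal{E}\text{ is an ellipsoid and } L\subseteq\mathcal{E}\Big\}.$$ "Absolute constant" means a constant that does not depend on $n$, $K$, or any other parameter. *)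

theory Defs
  imports "HOL-Analysis.Analysis" "HOL-Library.Function_Algebras"
begin

text \<open>
  The constants of the theorem are chosen before the dimension \<open>n\<close>, so \<open>\<real>\<^sup>n\<close> cannot be a type here.
  It is rendered as \<^term>\<open>topspace (Euclidean_space n)\<close>, the sequences of type
  \<^typ>\<open>nat \<Rightarrow> real\<close> that vanish at all indices \<open>i \<ge> n\<close>. With the pointwise real vector space
  structure on functions, the library notions \<^const>\<open>convex\<close>, \<^const>\<open>hull\<close> and \<^const>\<open>linear\<close>
  apply to such sets.
\<close>

instantiation "fun" :: (type, real_vector) real_vector
begin

definition scaleR_fun_def: "scaleR c f = (\<lambda>x. c *\<^sub>R f x)"

instance
  by standard (simp_all add: scaleR_fun_def fun_eq_iff algebra_simps)

end

abbreviation Rn :: "nat \<Rightarrow> (nat \<Rightarrow> real) set"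
  where "Rn n \<equiv> topspace (Euclidean_space n)"

text \<open>
  The product measure lives on functions with domain \<open>{..<n}\<close> that are \<open>undefined\<close> outside of it;
  it is pushed forward along the identification of those with \<^term>\<open>Rn n\<close>. The result is a Borel
  measure on all sequences that is concentrated on \<^term>\<open>Rn n\<close>.
\<close>

definition lborel_Rn :: "nat \<Rightarrow> (nat \<Rightarrow> real) measure"
  where "lborel_Rn n = distr (\<Pi>\<^sub>M i\<in>{..<n}. lborel) borel (\<lambda>x i. if i < n then x i else 0)"

definition vol :: "nat \<Rightarrow> (nat \<Rightarrow> real) set \<Rightarrow> real"
  where "vol n K = measure (lborel_Rn n) K"

definition convex_body :: "nat \<Rightarrow> (nat \<Rightarrow> real) set \<Rightarrow> bool"
  where "convex_body n K \<longleftrightarrow>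
    compactin (Euclidean_space n) K \<and> convex K \<and> Euclidean_space n interior_of K \<noteq> {}"

definition center_of_mass :: "nat \<Rightarrow> (nat \<Rightarrow> real) set \<Rightarrow> nat \<Rightarrow> real"
  where "center_of_mass n K = (1 / vol n K) *\<^sub>R (\<lambda>i. LINT x:K|lborel_Rn n. x i)"

definition centered_convex_body :: "nat \<Rightarrow> (nat \<Rightarrow> real) set \<Rightarrow> bool"
  where "centered_convex_body n K \<longleftrightarrow> convex_body n K \<and> center_of_mass n K = 0"

definition minkowski_functional :: "'a::real_vector set \<Rightarrow> 'a \<Rightarrow> real"
  where "minkowski_functional K x = Inf {t. t > 0 \<and> x \<in> (*\<^sub>R) t ` K}"

definition vertex_index :: "nat \<Rightarrow> (nat \<Rightarrow> real) set \<Rightarrow> real"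
  where "vertex_index n K =
    Inf {\<Sum>j<N. minkowski_functional K (y j) | (N::nat) (y :: nat \<Rightarrow> nat \<Rightarrow> real).
      N \<ge> 1 \<and> (\<forall>j<N. y j \<in> Rn n) \<and> K \<subseteq> convex hull (y ` {..<N})}"

definition unit_ball :: "nat \<Rightarrow> (nat \<Rightarrow> real) set"
  where "unit_ball n = {x \<in> Rn n. (\<Sum>i<n. (x i)\<^sup>2) \<le> 1}"

text \<open>
  Ellipsoids are the images of the Euclidean unit ball under the invertible affine maps of
  \<open>\<real>\<^sup>n\<close>; they may have any center. Every linear map on \<^term>\<open>Rn n\<close> is the
  restriction of a linear map on all sequences, and only the values of \<open>T\<close> on \<^term>\<open>Rn n\<close> matter.
\<close>

definition ellipsoid :: "nat \<Rightarrow> (nat \<Rightarrow> real) set \<Rightarrow> bool"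
  where "ellipsoid n E \<longleftrightarrow>
    (\<exists>T c. linear T \<and> bij_betw T (Rn n) (Rn n) \<and> c \<in> Rn n \<and> E = (\<lambda>x. c + T x) ` unit_ball n)"

definition outer_volume_ratio :: "nat \<Rightarrow> (nat \<Rightarrow> real) set \<Rightarrow> real"
  where "outer_volume_ratio n L =
    Inf {(vol n E / vol n L) powr (1 / real n) | E. ellipsoid n E \<and> L \<subseteq> E}"

end

theory Submission
  imports Defs
begin

text \<open>
  Upper bound. Choose \<open>w\<^sub>1, \<dots>, w\<^sub>n \<in> K\<close> whose determinant is at least half of the supremum. By
  Cramer's rule every point of \<open>K\<close> is \<open>\<Sum> t\<^sub>i w\<^sub>i\<close> with \<open>\<bar>t\<^sub>i\<bar> \<le> 2\<close>, so \<open>K\<close> lies in the convex hull of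
  \<open>0\<close>, the points \<open>8 n w\<^sub>i\<close> and the point \<open>- 4 \<Sum> w\<^sub>i\<close>. The first \<open>n\<close> vertices cost at most \<open>8 n\<close> each.
  Since \<open>K\<close> is centered, \<open>- K \<subseteq> n K\<close>, so the last one costs at most \<open>4 n\<^sup>2\<close>.

  Lower bound. Let \<open>conv(K, - K)\<close> be contained in an ellipsoid, which may be taken to be a linear
  image \<open>T B\<close> of the unit ball, and let \<open>K \<subseteq> conv(y\<^sub>1, \<dots>, y\<^sub>N)\<close>. Put \<open>z\<^sub>j = T\<^sup>-\<^sup>1 y\<^sub>j\<close>, so that
  \<open>p\<^sub>K(y\<^sub>j) \<ge> \<bar>z\<^sub>j\<bar>\<close>, and let \<open>s\<close> be the sum of the \<open>p\<^sub>K(y\<^sub>j)\<close>. By Caratheodory's theorem the symmetric hull of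
  the \<open>z\<^sub>j\<close> is covered by simplices spanned by 0 and \<open>n\<close> of the points \<open>\<plusminus> z\<^sub>j\<close>. By Hadamard's
  inequality each has volume at most the product of the norms divided by \<open>n!\<close>; summing over all
  choices, the hull has volume at most \<open>(2 s)\<^sup>n / n!\<^sup>2\<close>. Since \<open>\<bar>B\<bar> \<ge> (2 / sqrt n)\<^sup>n\<close> and
  \<open>n! \<ge> (n / e)\<^sup>n\<close>, this gives \<open>s \<ge> e\<^sup>-\<^sup>2 n\<^sup>3\<^sup>/\<^sup>2 (\<bar>conv(K, - K)\<bar> / \<bar>T B\<bar>)\<^sup>1\<^sup>/\<^sup>n\<close>.
\<close>

section \<open>Coordinates and linear dependence in \<open>Rn n\<close>\<close>

lemma mem_Rn: "x \<in> Rn n \<longleftrightarrow> (\<forall>i\<ge>n. x i = 0)"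
  by (simp add: topspace_Euclidean_space)

lemma scaleR_fun_apply [simp]: "(c *\<^sub>R f) x = c *\<^sub>R f x"
  by (simp add: scaleR_fun_def)

lemma sum_fun_apply [simp]: "(\<Sum>a\<in>A. f a) x = (\<Sum>a\<in>A. f a x)"
  by (induction A rule: infinite_finite_induct) auto

lemma subspace_Rn: "subspace (Rn n)"
  by (auto simp: subspace_def mem_Rn)

definition unit_vec :: "nat \<Rightarrow> nat \<Rightarrow> real"
  where "unit_vec i = (\<lambda>k. if k = i then 1 else 0)"

lemma unit_vec_apply [simp]: "unit_vec i k = (if k = i then 1 else 0)"
  by (simp add: unit_vec_def)

lemma unit_vec_in_Rn [simp]: "i < n \<Longrightarrow> unit_vec i \<in> Rn n"
  by (simp add: mem_Rn)

lemma Rn_expansion: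
  assumes "x \<in> Rn n"
  shows "x = (\<Sum>i<n. x i *\<^sub>R unit_vec i)"
  using assms by (auto simp: mem_Rn fun_eq_iff if_distrib cong: if_cong)

text \<open>Stated for families, so that repeated vectors need no special treatment later: two equal
  members carry the relation with coefficients 1 and -1. For an injective family the bound on
  independent sets in the span of the n unit vectors applies.\<close>

lemma linear_relation:
  fixes z :: "'i \<Rightarrow> nat \<Rightarrow> real"
  assumes fin: "finite I" and card: "n < card I" and z: "\<And>i. i \<in> I \<Longrightarrow> z i \<in> Rn n"
  obtains c where "\<exists>i\<in>I. c i \<noteq> 0" "(\<Sum>i\<in>I. c i *\<^sub>R z i) = 0"
proof (cases "inj_on z I")
  case False
  then obtain i j where ij: "i \<in> I" "j \<in> I" "i \<noteq> j" "z i = z j"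
    by (auto simp: inj_on_def)
  define c where "c = (\<lambda>k. if k = i then 1 else if k = j then -1 else (0::real))"
  have "(\<Sum>k\<in>I. c k *\<^sub>R z k) = (\<Sum>k\<in>{i, j}. c k *\<^sub>R z k)"
    using ij fin by (intro sum.mono_neutral_right) (auto simp: c_def)
  also have "\<dots> = 0"
    using ij by (simp add: c_def)
  finally show ?thesis
    using that[of c] ij(1) by (metis c_def zero_neq_one)
next
  case True
  have "z ` I \<subseteq> span (unit_vec ` {..<n})"
  proof
    fix x assume "x \<in> z ` I"
    then have "x \<in> Rn n" using z by auto
    then have "x = (\<Sum>i<n. x i *\<^sub>R unit_vec i)" by (rule Rn_expansion)
    also have "\<dots> \<in> span (unit_vec ` {..<n})"
      by (intro span_sum span_scale span_base) auto
    finally show "x \<in> span (unit_vec ` {..<n})" .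
  qed
  moreover have "card (unit_vec ` {..<n}) \<le> n"
    using card_image_le[of "{..<n}" unit_vec] by simp
  ultimately have "dependent (z ` I)"
    using independent_span_bound[of "unit_vec ` {..<n}" "z ` I"] card card_image[OF True] by fastforce
  then obtain u v where u: "v \<in> z ` I" "u v \<noteq> 0" "(\<Sum>v\<in>z ` I. u v *\<^sub>R v) = 0"
    using fin by (auto simp: dependent_finite)
  have "(\<Sum>i\<in>I. u (z i) *\<^sub>R z i) = 0"
    using u(3) by (simp add: sum.reindex[OF True])
  then show ?thesis
    using that[of "u \<circ> z"] u(1,2) by auto
qed

section \<open>Determinants\<close>

text \<open>The determinant of the rows \<open>w 0\<close>, ..., \<open>w (n - 1)\<close>, written
  by the Leibniz formula because the dimension is a variable and not a type.\<close>

definition leibniz_det :: "nat \<Rightarrow> (nat \<Rightarrow> nat \<Rightarrow> real) \<Rightarrow> real"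
  where "leibniz_det n w = (\<Sum>p | p permutes {..<n}. of_int (sign p) * (\<Prod>i<n. w i (p i)))"

text \<open>This form exhibits linearity in row i: the new row enters each summand exactly once, as
  the factor \<open>x (p i)\<close>.\<close>

lemma leibniz_det_upd:
  assumes "i < n"
  shows "leibniz_det n (w(i := x)) =
    (\<Sum>p | p permutes {..<n}. of_int (sign p) * (\<Prod>k\<in>{..<n} - {i}. w k (p k)) * x (p i))"
proof -
  have "(\<Prod>k<n. (w(i := x)) k (p k)) = x (p i) * (\<Prod>k\<in>{..<n} - {i}. w k (p k))" for p
    using assms by (subst prod.remove[of _ i]) auto
  then show ?thesis
    by (simp add: leibniz_det_def mult_ac)
qed

text \<open>Composition with the transposition of i and j permutes the summands, reverses their
  signs and keeps their products, so the determinant equals its own negative.\<close>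

lemma leibniz_det_identical:
  assumes ij: "i < n" "j < n" "i \<noteq> j" and eq: "w i = w j"
  shows "leibniz_det n w = 0"
proof -
  let ?t = "Transposition.transpose i j"
  let ?P = "{p. p permutes {..<n}}"
  have t: "?t permutes {..<n}"
    using ij by (simp add: permutes_swap_id)
  have bij: "bij_betw (\<lambda>p. p \<circ> ?t) ?P ?P"
    by (rule bij_betwI[where g = "\<lambda>p. p \<circ> ?t"])
      (auto intro: permutes_compose[OF t] simp: o_assoc[symmetric])
  have step: "of_int (sign (p \<circ> ?t)) * (\<Prod>k<n. w k ((p \<circ> ?t) k)) = - (of_int (sign p) * (\<Prod>k<n. w k (p k)))"
    if "p \<in> ?P" for p
  proof -
    have "sign (p \<circ> ?t) = - sign p"
      using that t ij permutes_imp_permutation[of "{..<n}"]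
      by (auto simp: sign_compose sign_swap_id)
    \<comment> \<open>Since rows i and j agree, the row index may be transposed as well; then the
      whole product is merely reindexed.\<close>
    moreover have "(\<Prod>k<n. w k ((p \<circ> ?t) k)) = (\<Prod>k<n. w (?t k) (p (?t k)))"
      using eq by (intro prod.cong) (auto simp: Transposition.transpose_def)
    moreover have "(\<Prod>k<n. w (?t k) (p (?t k))) = (\<Prod>k<n. w k (p k))"
      using prod.permute[OF t, of "\<lambda>k. w k (p k)"] by (simp add: o_def)
    ultimately show ?thesis by simp
  qed
  have "leibniz_det n w = (\<Sum>p\<in>?P. of_int (sign (p \<circ> ?t)) * (\<Prod>k<n. w k ((p \<circ> ?t) k)))"
    unfolding leibniz_det_def by (rule sum.reindex_bij_betw[OF bij, symmetric])
  also have "\<dots> = - leibniz_det n w"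
    unfolding leibniz_det_def sum_negf[symmetric] using step by (intro sum.cong) auto
  finally show ?thesis by simp
qed

text \<open>Cramer's rule. By linearity in row i only the term j = i survives, because every other
  term has two equal rows.\<close>

lemma leibniz_det_upd_sum:
  assumes i: "i < n"
  shows "leibniz_det n (w(i := \<Sum>j<n. t j *\<^sub>R w j)) = t i * leibniz_det n w"
proof -
  have "leibniz_det n (w(i := \<Sum>j<n. t j *\<^sub>R w j)) = (\<Sum>j<n. t j * leibniz_det n (w(i := w j)))"
    unfolding leibniz_det_upd[OF i]
    unfolding sum_fun_apply sum_distrib_left by (subst sum.swap) (simp add: mult_ac)
  also have "\<dots> = (\<Sum>j<n. if j = i then t i * leibniz_det n w else 0)"
    using leibniz_det_identical[of i n _ "w(i := w _)"] i by (intro sum.cong) auto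
  finally show ?thesis using i by simp
qed

lemma leibniz_det_diagonal: "leibniz_det n (\<lambda>i. r *\<^sub>R unit_vec i) = r ^ n"
proof -
  have "(\<Prod>i<n. (r *\<^sub>R unit_vec i) (p i)) = 0" if p: "p permutes {..<n}" "p \<noteq> id" for p
  proof -
    obtain i where "p i \<noteq> i" using p(2) by (auto simp: fun_eq_iff)
    moreover from this have "i < n" using p(1) by (auto simp: permutes_def)
    ultimately show ?thesis by (intro prod_zero) auto
  qed
  then have "leibniz_det n (\<lambda>i. r *\<^sub>R unit_vec i) =
      (\<Sum>p\<in>{id}. of_int (sign p) * (\<Prod>i<n. (r *\<^sub>R unit_vec i) (p i)))"
    unfolding leibniz_det_def
    by (intro sum.mono_neutral_right) (auto simp: permutes_id finite_permutations)
  then show ?thesis by (simp add: sign_id)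
qed

lemma leibniz_det_bounded:
  assumes "\<And>i k. i < n \<Longrightarrow> k < n \<Longrightarrow> \<bar>w i k\<bar> \<le> R"
  shows "\<bar>leibniz_det n w\<bar> \<le> fact n * R ^ n"
proof -
  have "\<bar>leibniz_det n w\<bar> \<le> (\<Sum>p | p permutes {..<n}. R ^ n)"
    unfolding leibniz_det_def
  proof (rule order_trans[OF sum_abs], rule sum_mono)
    fix p assume p: "p \<in> {p. p permutes {..<n}}"
    have "\<bar>\<Prod>i<n. w i (p i)\<bar> \<le> (\<Prod>i<n. R)"
      unfolding abs_prod using assms p by (intro prod_mono) (auto simp: permutes_in_image[of p "{..<n}", simplified])
    then show "\<bar>real_of_int (sign p) * (\<Prod>i<n. w i (p i))\<bar> \<le> R ^ n"
      by (simp add: abs_mult sign_def)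
  qed
  also have "\<dots> = fact n * R ^ n"
    by (simp add: card_permutations[of "{..<n}" n])
  finally show ?thesis .
qed

text \<open>The vectors \<open>w 0\<close>, ..., \<open>w (n - 1)\<close>, x are n + 1 vectors in
  dimension n, hence dependent. The coefficient of x in a relation cannot vanish, so the relation
  can be solved for x.\<close>

lemma expand_in_det_basis:
  assumes w: "\<And>i. i < n \<Longrightarrow> w i \<in> Rn n" and det: "leibniz_det n w \<noteq> 0" and x: "x \<in> Rn n"
  obtains t where "x = (\<Sum>i<n. t i *\<^sub>R w i)"
proof -
  have "\<And>i. i \<in> {..n} \<Longrightarrow> (w(n := x)) i \<in> Rn n" using w x by auto
  from linear_relation[of "{..n}" n "w(n := x)", OF _ _ this]
  obtain c where c: "\<exists>i\<in>{..n}. c i \<noteq> 0" "(\<Sum>i\<le>n. c i *\<^sub>R (w(n := x)) i) = 0"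
    by auto
  have rel: "(\<Sum>i<n. c i *\<^sub>R w i) + c n *\<^sub>R x = 0"
    using c(2) by (simp add: lessThan_Suc_atMost[symmetric] add.commute)
  have "c n \<noteq> 0"
  proof
    assume "c n = 0"
    then obtain i where i: "i < n" "c i \<noteq> 0" using c(1) by (metis atMost_iff le_neq_implies_less)
    \<comment> \<open>With \<open>c n = 0\<close> the new row is zero, whereas Cramer's rule makes
      this determinant \<open>c i\<close> times the nonzero determinant of w.\<close>
    have "leibniz_det n (w(i := \<Sum>j<n. c j *\<^sub>R w j)) = 0"
      using rel \<open>c n = 0\<close> by (simp add: leibniz_det_upd[OF i(1)])
    then show False using leibniz_det_upd_sum[OF i(1)] i det by simp
  qed
  then have "x = (1 / c n) *\<^sub>R (c n *\<^sub>R x)" by (simp add: scaleR_scaleR)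
  also have "c n *\<^sub>R x = (\<Sum>i<n. - c i *\<^sub>R w i)"
    using rel by (simp add: sum_negf eq_neg_iff_add_eq_0 add.commute)
  finally have "x = (\<Sum>i<n. (1 / c n * - c i) *\<^sub>R w i)"
    by (simp only: scaleR_sum_right scaleR_scaleR)
  then show ?thesis by (rule that)
qed

text \<open>Members of \<open>A\<close> whose determinant is at least half the supremum: by Cramer's rule the
  coefficients are at most 2, and no maximiser has to exist.\<close>

lemma bounded_coefficients_basis:
  assumes A: "A \<subseteq> Rn n" and bd: "\<forall>x\<in>A. \<forall>i. \<bar>x i\<bar> \<le> R"
    and r: "r > 0" "\<forall>i<n. r *\<^sub>R unit_vec i \<in> A"
  obtains w where "\<forall>i<n. w i \<in> A"
    "\<forall>x\<in>A. \<exists>t. x = (\<Sum>i<n. t i *\<^sub>R w i) \<and> (\<forall>i<n. \<bar>t i\<bar> \<le> 2)"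
proof -
  define D where "D = {\<bar>leibniz_det n w\<bar> | w. \<forall>i<n. w i \<in> A}"
  have bdd: "bdd_above D"
    unfolding D_def bdd_above_def using leibniz_det_bounded[of n _ R] bd by blast
  \<comment> \<open>The multiples of the unit vectors show that the supremum of the determinants is
    positive.\<close>
  have rD: "r ^ n \<in> D"
    unfolding D_def using r leibniz_det_diagonal[of n r]
    by (auto intro!: exI[of _ "\<lambda>i. r *\<^sub>R unit_vec i"])
  have pos: "0 < Sup D"
    using cSup_upper[OF rD bdd] r(1) by (meson less_le_trans zero_less_power)
  then have "Sup D / 2 < Sup D" by simp
  then obtain d where "d \<in> D" "Sup D / 2 < d"
    using less_cSup_iff[of D "Sup D / 2"] rD bdd by auto
  then obtain w where w: "\<And>i. i < n \<Longrightarrow> w i \<in> A" and half: "Sup D / 2 < \<bar>leibniz_det n w\<bar>"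
    by (auto simp: D_def)
  show ?thesis
  proof (rule that[of w])
    show "\<forall>i<n. w i \<in> A" using w by blast
    show "\<forall>x\<in>A. \<exists>t. x = (\<Sum>i<n. t i *\<^sub>R w i) \<and> (\<forall>i<n. \<bar>t i\<bar> \<le> 2)"
    proof
      fix x assume x: "x \<in> A"
      have "leibniz_det n w \<noteq> 0" using half pos by auto
      then obtain t where t: "x = (\<Sum>i<n. t i *\<^sub>R w i)"
        using expand_in_det_basis[of n w x] w x A by blast
      have "\<bar>t i\<bar> \<le> 2" if i: "i < n" for i
      proof -
        have "\<bar>leibniz_det n (w(i := x))\<bar> \<in> D"
          unfolding D_def using w x by (auto intro!: exI[of _ "w(i := x)"])
        \<comment> \<open>The family with \<open>w i\<close> replaced by x also competes for the
          supremum, and Cramer's rule gives its determinant as \<open>t i\<close> times the old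
          one.\<close>
        then have "\<bar>t i\<bar> * \<bar>leibniz_det n w\<bar> \<le> Sup D"
          using cSup_upper[OF _ bdd] leibniz_det_upd_sum[OF i, of w t] t by (auto simp: abs_mult)
        also have "\<dots> \<le> 2 * \<bar>leibniz_det n w\<bar>" using half by simp
        finally show ?thesis using half pos by (simp add: mult_le_cancel_right)
      qed
      with t show "\<exists>t. x = (\<Sum>i<n. t i *\<^sub>R w i) \<and> (\<forall>i<n. \<bar>t i\<bar> \<le> 2)" by blast
    qed
  qed
qed

section \<open>Caratheodory's theorem\<close>

text \<open>Coefficient sums at most 1 mean that the origin is a free extra vertex, so n further
  points suffice instead of n + 1. In a representation with the fewest points, more than n points
  would satisfy a linear relation; subtracting a multiple of it removes one point.\<close>

lemma caratheodory_cone: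
  fixes z :: "'i \<Rightarrow> nat \<Rightarrow> real"
  assumes J: "finite J" "\<And>j. j \<in> J \<Longrightarrow> z j \<in> Rn n"
    and t: "\<And>j. j \<in> J \<Longrightarrow> 0 \<le> t j" "(\<Sum>j\<in>J. t j) \<le> (1::real)"
  obtains I u where "I \<subseteq> J" "card I \<le> n" "\<And>i. i \<in> I \<Longrightarrow> 0 \<le> u i" "(\<Sum>i\<in>I. u i) \<le> (1::real)"
    "(\<Sum>j\<in>J. t j *\<^sub>R z j) = (\<Sum>i\<in>I. u i *\<^sub>R z i)"
proof -
  define x where "x = (\<Sum>j\<in>J. t j *\<^sub>R z j)"
  define P where "P k \<longleftrightarrow> (\<exists>I u. I \<subseteq> J \<and> card I = k \<and> (\<forall>i\<in>I. 0 \<le> u i) \<and> (\<Sum>i\<in>I. u i) \<le> (1::real) \<and>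
    x = (\<Sum>i\<in>I. u i *\<^sub>R z i))" for k
  have "P (card J)" unfolding P_def x_def using t by blast
  define k where "k = (LEAST k. P k)"
  have "P k" unfolding k_def using \<open>P (card J)\<close> by (rule LeastI)
  then obtain I u where I: "I \<subseteq> J" "card I = k" "\<And>i. i \<in> I \<Longrightarrow> 0 \<le> u i"
    "(\<Sum>i\<in>I. u i) \<le> (1::real)" "x = (\<Sum>i\<in>I. u i *\<^sub>R z i)"
    unfolding P_def by blast
  have fI: "finite I" using I(1) J(1) finite_subset by blast
  have "k \<le> n"
  proof (rule ccontr)
    assume "\<not> k \<le> n"
    then have "n < card I" using I by simp
    from linear_relation[OF fI this] J(2) I(1)
    obtain c where c0: "\<exists>i\<in>I. c i \<noteq> 0" "(\<Sum>i\<in>I. c i *\<^sub>R z i) = 0" by blast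
    \<comment> \<open>The relation is taken with nonnegative coefficient sum, if necessary after
      negation, so that subtracting it cannot raise the sum of the weights. Such a relation has a
      positive coefficient, because not all coefficients vanish.\<close>
    obtain c where c: "\<exists>i\<in>I. c i > 0" "(\<Sum>i\<in>I. c i *\<^sub>R z i) = 0" "(\<Sum>i\<in>I. c i) \<ge> (0::real)"
    proof -
      have neg: "(\<Sum>i\<in>I. (- c i) *\<^sub>R z i) = 0" using c0(2) by (simp add: sum_negf)
      have ex: "\<exists>i\<in>I. d i > 0" if "\<exists>i\<in>I. d i \<noteq> 0" "(\<Sum>i\<in>I. d i) \<ge> 0" for d :: "'i \<Rightarrow> real"
      proof (rule ccontr)
        assume "\<not> ?thesis"
        then have le: "\<And>i. i \<in> I \<Longrightarrow> - d i \<ge> 0" by force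
        then have "(\<Sum>i\<in>I. - d i) = 0"
          using that(2) sum_nonneg[of I "\<lambda>i. - d i"] by (simp add: sum_negf)
        then show False
          using sum_nonneg_eq_0_iff[OF fI, of "\<lambda>i. - d i"] le that(1) by auto
      qed
      show ?thesis
      proof (cases "(\<Sum>i\<in>I. c i) \<ge> 0")
        case True then show ?thesis using that[of c] ex[of c] c0 by blast
      next
        case False then show ?thesis
          using that[of "\<lambda>i. - c i"] ex[of "\<lambda>i. - c i"] c0 neg by (auto simp: sum_negf)
      qed
    qed
    define Q where "Q = {i\<in>I. c i > 0}"
    \<comment> \<open>The largest multiple of the relation that can be subtracted with all weights
      staying nonnegative; at the minimising index the weight becomes 0.\<close>
    define a where "a = Min ((\<lambda>i. u i / c i) ` Q)"
    have Q: "finite Q" "Q \<noteq> {}" using c(1) fI by (auto simp: Q_def)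
    have "a \<in> (\<lambda>i. u i / c i) ` Q" unfolding a_def using Q by (intro Min_in) auto
    then obtain m where m: "m \<in> Q" "a = u m / c m" by blast
    have a0: "a \<ge> 0" using m I(3) by (auto simp: Q_def)
    define v where "v = (\<lambda>i. u i - a * c i)"
    have v0: "v i \<ge> 0" if "i \<in> I" for i
    proof (cases "c i > 0")
      case True
      then have "a \<le> u i / c i" unfolding a_def using Q that by (intro Min_le) (auto simp: Q_def)
      then show ?thesis using True by (simp add: v_def field_simps)
    next
      case False
      then have "a * c i \<le> 0" using a0 by (simp add: mult_nonneg_nonpos)
      then show ?thesis using I(3)[OF that] by (simp add: v_def)
    qed
    have mI: "m \<in> I" "v m = 0" using m by (auto simp: Q_def v_def)
    have "(\<Sum>i\<in>I. v i *\<^sub>R z i) = x - a *\<^sub>R (\<Sum>i\<in>I. c i *\<^sub>R z i)"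
      unfolding I(5) by (simp add: v_def scaleR_left_diff_distrib sum_subtractf scaleR_sum_right)
    then have "x = (\<Sum>i\<in>I. v i *\<^sub>R z i)" using c(2) by simp
    then have x: "x = (\<Sum>i\<in>I - {m}. v i *\<^sub>R z i)"
      using sum.remove[OF fI mI(1), of "\<lambda>i. v i *\<^sub>R z i"] mI(2) by simp
    have "(\<Sum>i\<in>I. v i) = (\<Sum>i\<in>I. u i) - a * (\<Sum>i\<in>I. c i)"
      by (simp add: v_def sum_subtractf sum_distrib_left)
    also have "\<dots> \<le> 1" using I(4) a0 c(3) by (smt (verit) mult_nonneg_nonneg)
    finally have "(\<Sum>i\<in>I - {m}. v i) \<le> 1"
      using sum.remove[OF fI mI(1), of v] mI(2) by simp
    then have "P (card (I - {m}))"
      unfolding P_def using x v0 I(1) by (intro exI[of _ "I - {m}"] exI[of _ v]) auto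
    then have "k \<le> card (I - {m})" unfolding k_def by (rule Least_le)
    then show False using card_Diff1_less[OF fI mI(1)] I(2) by simp
  qed
  then show ?thesis using that[of I u] I unfolding x_def by blast
qed

section \<open>Lebesgue measure\<close>

lemma sets_lborel_Rn [measurable_cong]: "sets (lborel_Rn n) = sets borel"
  by (simp add: lborel_Rn_def)

lemma space_lborel_Rn [simp]: "space (lborel_Rn n) = UNIV"
  by (simp add: lborel_Rn_def)

lemma measurable_fun_borelI:
  fixes f :: "'a \<Rightarrow> nat \<Rightarrow> real"
  assumes "\<And>i. (\<lambda>x. f x i) \<in> borel_measurable M"
  shows "f \<in> borel_measurable M"
  using assms by (rule measurable_coordinatewise_then_product)

lemma borel_measurable_coordinate:
  fixes f :: "'a \<Rightarrow> nat \<Rightarrow> real"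
  assumes "f \<in> borel_measurable M"
  shows "(\<lambda>x. f x i) \<in> borel_measurable M"
  using assms by (rule measurable_product_then_coordinatewise)

lemma
  fixes f g :: "'a \<Rightarrow> nat \<Rightarrow> real"
  assumes f: "f \<in> borel_measurable M" and g: "g \<in> borel_measurable M"
  shows borel_measurable_fun_add [measurable (raw)]: "(\<lambda>x. f x + g x) \<in> borel_measurable M"
    and borel_measurable_fun_diff [measurable (raw)]: "(\<lambda>x. f x - g x) \<in> borel_measurable M"
  using borel_measurable_coordinate[OF f] borel_measurable_coordinate[OF g]
  by (auto intro!: measurable_fun_borelI)

lemma borel_measurable_fun_uminus [measurable (raw)]:
  fixes f :: "'a \<Rightarrow> nat \<Rightarrow> real"
  assumes f: "f \<in> borel_measurable M"
  shows "(\<lambda>x. - f x) \<in> borel_measurable M"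
  using borel_measurable_coordinate[OF f] by (auto intro!: measurable_fun_borelI)

lemma borel_measurable_fun_scaleR [measurable (raw)]:
  fixes f :: "'a \<Rightarrow> nat \<Rightarrow> real"
  assumes f: "f \<in> borel_measurable M" and h: "h \<in> borel_measurable M"
  shows "(\<lambda>x. h x *\<^sub>R f x) \<in> borel_measurable M"
  using borel_measurable_coordinate[OF f] h by (auto intro!: measurable_fun_borelI)

lemma borel_measurable_fun_upd [measurable (raw)]:
  fixes f :: "'a \<Rightarrow> nat \<Rightarrow> real"
  assumes f: "f \<in> borel_measurable M" and h: "h \<in> borel_measurable M"
  shows "(\<lambda>x. (f x)(k := h x)) \<in> borel_measurable M"
  using borel_measurable_coordinate[OF f] h by (auto intro!: measurable_fun_borelI)

lemma measurable_PiM_embedding [measurable]: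
  "(\<lambda>x i. if i < n then x i else 0) \<in> (\<Pi>\<^sub>M i\<in>{..<n}. lborel) \<rightarrow>\<^sub>M (borel :: (nat \<Rightarrow> real) measure)"
proof (rule measurable_fun_borelI)
  fix i show "(\<lambda>x. if i < n then x i else 0) \<in> borel_measurable (\<Pi>\<^sub>M i\<in>{..<n}. lborel)"
    by (cases "i < n") auto
qed

lemma closed_Rn: "closed (Rn n)"
  by (metis closedin_Euclidean_space_iff closedin_topspace)

lemma sets_Rn [measurable]: "Rn n \<in> sets borel"
  using closed_Rn by (rule borel_closed)

lemma AE_lborel_Rn: "AE x in lborel_Rn n. x \<in> Rn n"
  unfolding lborel_Rn_def by (subst AE_distr_iff) (auto simp: mem_Rn)

interpretation lborel_prod: product_sigma_finite "\<lambda>i::nat. lborel :: real measure"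
  by standard

lemma sets_box:
  assumes "\<And>i. i < n \<Longrightarrow> A i \<in> sets borel"
  shows "{x :: nat \<Rightarrow> real. \<forall>i<n. x i \<in> A i} \<in> sets borel"
proof -
  have "{x :: nat \<Rightarrow> real. \<forall>i<n. x i \<in> A i} = (\<Inter>i\<in>{..<n}. (\<lambda>x. x i) -` A i \<inter> space borel) \<inter> space borel"
    by auto
  also have "\<dots> \<in> sets borel"
    using assms by (intro sets.Int sets.top sets.countable_INT'' measurable_sets[of _ borel borel]) auto
  finally show ?thesis .
qed

lemma emeasure_lborel_Rn_box:
  assumes "\<And>i. i < n \<Longrightarrow> A i \<in> sets borel"
  shows "emeasure (lborel_Rn n) {x. \<forall>i<n. x i \<in> A i} = (\<Prod>i<n. emeasure lborel (A i))"
proof -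
  have eq: "(\<lambda>x i. if i < n then x i else 0) -` {x. \<forall>i<n. x i \<in> A i} \<inter>
      space (\<Pi>\<^sub>M i\<in>{..<n}. lborel) = Pi\<^sub>E {..<n} A"
    by (intro set_eqI) (simp only: space_PiM PiE_iff vimage_eq mem_Collect_eq Int_iff space_lborel space_borel
        UNIV_I lessThan_iff Ball_def if_True simp_thms, meson)
  have "emeasure (lborel_Rn n) {x. \<forall>i<n. x i \<in> A i} = emeasure (\<Pi>\<^sub>M i\<in>{..<n}. lborel) (Pi\<^sub>E {..<n} A)"
    unfolding lborel_Rn_def eq[symmetric]
    by (rule emeasure_distr[OF measurable_PiM_embedding sets_box[of n A, OF assms]])
  also have "\<dots> = (\<Prod>i<n. emeasure lborel (A i))"
    using assms by (intro lborel_prod.emeasure_PiM) auto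
  finally show ?thesis .
qed

lemma sigma_finite_lborel_Rn: "sigma_finite_measure (lborel_Rn n)"
proof
  \<comment> \<open>These sets restrict only the first n coordinates, so they exhaust the whole
    sequence space and not just \<open>Rn n\<close>.\<close>
  define C where "C = (\<lambda>k::nat. {x :: nat \<Rightarrow> real. \<forall>i<n. x i \<in> {- real k..real k}})"
  have C: "C k \<in> sets borel" for k
    unfolding C_def by (rule sets_box) simp
  have "emeasure (lborel_Rn n) (C k) \<noteq> \<infinity>" for k
  proof -
    have "emeasure (lborel_Rn n) (C k) = (\<Prod>i<n. ennreal (real k - - real k))"
      unfolding C_def by (subst emeasure_lborel_Rn_box) auto
    also have "\<dots> = ennreal ((real k - - real k) ^ n)"
      by (subst prod_constant) (simp only: card_lessThan ennreal_power)
    finally show ?thesis by simp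
  qed
  moreover have "(\<Union>k. C k) = UNIV"
  proof (intro set_eqI iffI UNIV_I)
    fix x :: "nat \<Rightarrow> real"
    obtain k :: nat where k: "(\<Sum>i<n. \<bar>x i\<bar>) \<le> real k" using real_arch_simple by blast
    have "\<bar>x i\<bar> \<le> real k" if "i < n" for i
      using member_le_sum[of i "{..<n}" "\<lambda>i. \<bar>x i\<bar>"] that k by force
    then have "x \<in> C k" by (force simp: C_def abs_le_iff)
    then show "x \<in> (\<Union>k. C k)" by blast
  qed
  ultimately show "\<exists>A. countable A \<and> A \<subseteq> sets (lborel_Rn n) \<and> \<Union> A = space (lborel_Rn n) \<and>
      (\<forall>a\<in>A. emeasure (lborel_Rn n) a \<noteq> \<infinity>)"
    using C by (intro exI[of _ "range C"]) (auto simp: sets_lborel_Rn)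
qed

lemma nn_integral_lborel_Rn_0:
  assumes f: "f \<in> borel_measurable borel"
  shows "(\<integral>\<^sup>+x. f x \<partial>lborel_Rn 0) = f 0"
  using f unfolding lborel_Rn_def
  by (subst nn_integral_distr) (auto simp: PiM_empty zero_fun_def)

text \<open>Fubini's theorem with the last coordinate split off; the inductions on the dimension
  rest on this recursion.\<close>

lemma nn_integral_lborel_Rn_Suc:
  assumes f [measurable]: "f \<in> borel_measurable borel"
  shows "(\<integral>\<^sup>+x. f x \<partial>lborel_Rn (Suc n)) = (\<integral>\<^sup>+h. \<integral>\<^sup>+x. f (x(n := h)) \<partial>lborel_Rn n \<partial>lborel)"
proof -
  let ?e = "\<lambda>n x i. if i < n then x i else (0::real)"
  have "(\<integral>\<^sup>+x. f x \<partial>lborel_Rn (Suc n)) =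
      (\<integral>\<^sup>+x. f (?e (Suc n) x) \<partial>(\<Pi>\<^sub>M i\<in>insert n {..<n}. lborel))"
    using measurable_PiM_embedding[of "Suc n"]
    unfolding lborel_Rn_def by (subst nn_integral_distr) (simp_all add: lessThan_Suc)
  also have "\<dots> = (\<integral>\<^sup>+h. \<integral>\<^sup>+x. f (?e (Suc n) (x(n := h))) \<partial>(\<Pi>\<^sub>M i\<in>{..<n}. lborel) \<partial>lborel)"
    using measurable_compose[OF measurable_PiM_embedding[of "Suc n"] f]
    by (intro lborel_prod.product_nn_integral_insert_rev) (simp_all add: lessThan_Suc)
  also have "\<dots> = (\<integral>\<^sup>+h. \<integral>\<^sup>+x. f ((?e n x)(n := h)) \<partial>(\<Pi>\<^sub>M i\<in>{..<n}. lborel) \<partial>lborel)"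
    by (intro nn_integral_cong arg_cong[where f = f]) auto
  also have "\<dots> = (\<integral>\<^sup>+h. \<integral>\<^sup>+x. f (x(n := h)) \<partial>lborel_Rn n \<partial>lborel)"
    unfolding lborel_Rn_def by (intro nn_integral_cong, subst nn_integral_distr) simp_all
  finally show ?thesis .
qed

text \<open>Induction on the dimension: the last coordinate is substituted by the one-dimensional
  rule, which contributes one factor of the absolute value of c, and the others by the induction
  hypothesis.\<close>

lemma nn_integral_lborel_Rn_affine:
  assumes "f \<in> borel_measurable borel" "c \<noteq> 0" "v \<in> Rn n"
  shows "(\<integral>\<^sup>+x. f x \<partial>lborel_Rn n) = ennreal (\<bar>c\<bar> ^ n) * (\<integral>\<^sup>+x. f (v + c *\<^sub>R x) \<partial>lborel_Rn n)"
  using assms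
proof (induction n arbitrary: f v)
  case 0
  then have "v = 0" by (auto simp: mem_Rn fun_eq_iff)
  moreover have [measurable]: "f \<in> borel_measurable borel" by fact
  ultimately have "(\<integral>\<^sup>+x. f (v + c *\<^sub>R x) \<partial>lborel_Rn 0) = f 0"
    using nn_integral_lborel_Rn_0[of "\<lambda>x. f (v + c *\<^sub>R x)"] by simp
  then show ?case
    using nn_integral_lborel_Rn_0[of f] 0 by (simp only: power_0 ennreal_1 mult_1_left)
next
  case (Suc n)
  have [measurable]: "f \<in> borel_measurable borel" by fact
  interpret sigma_finite_measure "lborel_Rn n" by (rule sigma_finite_lborel_Rn)
  let ?v = "v(n := 0)"
  have v: "?v \<in> Rn n" using Suc.prems by (auto simp: mem_Rn)
  have upd: "(?v + c *\<^sub>R x)(n := v n + c * h) = v + c *\<^sub>R x(n := h)" for x h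
    by (auto simp: fun_eq_iff)
  have "(\<integral>\<^sup>+x. f x \<partial>lborel_Rn (Suc n)) = (\<integral>\<^sup>+h. \<integral>\<^sup>+x. f (x(n := h)) \<partial>lborel_Rn n \<partial>lborel)"
    by (rule nn_integral_lborel_Rn_Suc) fact
  also have "\<dots> = \<bar>c\<bar> * (\<integral>\<^sup>+h. \<integral>\<^sup>+x. f (x(n := v n + c * h)) \<partial>lborel_Rn n \<partial>lborel)"
    using Suc.prems by (intro nn_integral_real_affine) auto
  also have "\<dots> = \<bar>c\<bar> * (\<integral>\<^sup>+h. ennreal (\<bar>c\<bar> ^ n) *
      (\<integral>\<^sup>+x. f ((?v + c *\<^sub>R x)(n := v n + c * h)) \<partial>lborel_Rn n) \<partial>lborel)"
    by (intro arg_cong2[where f = "(*)"] refl nn_integral_cong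
        Suc.IH[where f = "\<lambda>x. f (x(n := v n + c * _))"] v \<open>c \<noteq> 0\<close>) measurable
  also have "\<dots> = ennreal (\<bar>c\<bar> ^ Suc n) * (\<integral>\<^sup>+h. (\<integral>\<^sup>+x. f (v + c *\<^sub>R x(n := h)) \<partial>lborel_Rn n) \<partial>lborel)"
  proof -
    have "(\<lambda>h. \<integral>\<^sup>+x. f (v + c *\<^sub>R x(n := h)) \<partial>lborel_Rn n) \<in> borel_measurable lborel"
      by measurable
    then show ?thesis
      unfolding upd by (subst nn_integral_cmult) (simp_all only: ennreal_mult power_Suc abs_ge_zero zero_le_power mult.assoc)
  qed
  also have "\<dots> = ennreal (\<bar>c\<bar> ^ Suc n) * (\<integral>\<^sup>+x. f (v + c *\<^sub>R x) \<partial>lborel_Rn (Suc n))"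
    by (intro arg_cong2[where f = "(*)"] refl nn_integral_lborel_Rn_Suc[symmetric]) measurable
  finally show ?case .
qed

text \<open>Preimages are used in place of images because their measurability is immediate.\<close>

lemma emeasure_lborel_Rn_affine_vimage:
  assumes A [measurable]: "A \<in> sets borel" and "c \<noteq> 0" "v \<in> Rn n"
  shows "emeasure (lborel_Rn n) A = ennreal (\<bar>c\<bar> ^ n) * emeasure (lborel_Rn n) {x. v + c *\<^sub>R x \<in> A}"
proof -
  have m: "{x. v + c *\<^sub>R x \<in> A} \<in> sets (lborel_Rn n)"
    using measurable_sets[of "\<lambda>x. v + c *\<^sub>R x" "lborel_Rn n" borel A] by (simp add: vimage_def)
  have "emeasure (lborel_Rn n) A = (\<integral>\<^sup>+x. indicator A x \<partial>lborel_Rn n)"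
    by (simp add: sets_lborel_Rn)
  also have "\<dots> = ennreal (\<bar>c\<bar> ^ n) * (\<integral>\<^sup>+x. indicator A (v + c *\<^sub>R x) \<partial>lborel_Rn n)"
    using assms by (intro nn_integral_lborel_Rn_affine) auto
  also have "(\<integral>\<^sup>+x. indicator A (v + c *\<^sub>R x) \<partial>lborel_Rn n) =
      (\<integral>\<^sup>+x. indicator {x. v + c *\<^sub>R x \<in> A} x \<partial>lborel_Rn n)"
    by (intro nn_integral_cong) (auto simp: indicator_def)
  also have "\<dots> = emeasure (lborel_Rn n) {x. v + c *\<^sub>R x \<in> A}"
    using m by (rule nn_integral_indicator)
  finally show ?thesis .
qed

text \<open>Uniqueness of Haar measure: both sides compute the double integral of
  \<open>indicator A (F x) * indicator B (y - F x)\<close>, once by translating \<open>y\<close>, once by translating \<open>x\<close>.\<close>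

lemma haar_uniqueness:
  assumes F [measurable]: "F \<in> borel_measurable borel"
    and add: "\<And>x y. F (x + y) = F x + F y"
    and maps: "\<And>x. x \<in> Rn n \<Longrightarrow> F x \<in> Rn n"
    and surj: "\<And>y. y \<in> Rn n \<Longrightarrow> \<exists>x\<in>Rn n. F x = y"
    and A [measurable]: "A \<in> sets borel" and B [measurable]: "B \<in> sets borel"
  shows "emeasure (lborel_Rn n) {x. F x \<in> A} * emeasure (lborel_Rn n) B =
    emeasure (lborel_Rn n) {x. - F x \<in> B} * emeasure (lborel_Rn n) A"
proof -
  let ?M = "lborel_Rn n"
  interpret sigma_finite_measure ?M by (rule sigma_finite_lborel_Rn)
  interpret P: pair_sigma_finite ?M ?M ..
  have mA: "{x. F x \<in> A} \<in> sets ?M"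
    using measurable_sets[of F ?M borel A] by (simp add: vimage_def)
  have mB: "{x. - F x \<in> B} \<in> sets ?M"
    using measurable_sets[of "\<lambda>x. - F x" ?M borel B] by (simp add: vimage_def)
  have em: "emeasure ?M A = (\<integral>\<^sup>+y. indicator A y \<partial>?M)" "emeasure ?M B = (\<integral>\<^sup>+y. indicator B y \<partial>?M)"
    by (simp_all add: sets_lborel_Rn)
  have trans: "(\<integral>\<^sup>+x. f (x + v) \<partial>?M) = (\<integral>\<^sup>+x. f x \<partial>?M)"
    if "f \<in> borel_measurable borel" "v \<in> Rn n" for f v
    using nn_integral_lborel_Rn_affine[of f 1 v n] that by (simp add: add.commute)
  have sp: "subspace (Rn n)" by (rule subspace_Rn)
  have "emeasure ?M {x. F x \<in> A} * emeasure ?M B = (\<integral>\<^sup>+x. indicator {x. F x \<in> A} x * emeasure ?M B \<partial>?M)"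
    using mA by (simp add: nn_integral_multc)
  also have "\<dots> = (\<integral>\<^sup>+x. \<integral>\<^sup>+y. indicator A (F x) * indicator B (y - F x) \<partial>?M \<partial>?M)"
  proof (rule nn_integral_cong_AE, rule eventually_mono[OF AE_lborel_Rn])
    fix x assume "x \<in> Rn n"
    then have "- F x \<in> Rn n" using maps subspace_neg[OF sp] by blast
    then have "emeasure ?M B = (\<integral>\<^sup>+y. indicator B (y + - F x) \<partial>?M)"
      unfolding em by (intro trans[symmetric]) auto
    then show "indicator {x. F x \<in> A} x * emeasure ?M B =
        (\<integral>\<^sup>+y. indicator A (F x) * indicator B (y - F x) \<partial>?M)"
      by (subst nn_integral_cmult) (auto simp: indicator_def)
  qed
  also have "\<dots> = (\<integral>\<^sup>+y. \<integral>\<^sup>+x. indicator A (F x) * indicator B (y - F x) \<partial>?M \<partial>?M)"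
    by (rule P.Fubini'[symmetric]) measurable
  also have "\<dots> = (\<integral>\<^sup>+y. \<integral>\<^sup>+x. indicator A (F x + y) * indicator B (- F x) \<partial>?M \<partial>?M)"
  proof (rule nn_integral_cong_AE, rule eventually_mono[OF AE_lborel_Rn])
    fix y assume "y \<in> Rn n"
    \<comment> \<open>Surjectivity enters here: translating x by a preimage u of y turns
      \<open>y - F x\<close> into \<open>- F x\<close>.\<close>
    then obtain u where u: "u \<in> Rn n" "F u = y" using surj by blast
    then show "(\<integral>\<^sup>+x. indicator A (F x) * indicator B (y - F x) \<partial>?M) =
        (\<integral>\<^sup>+x. indicator A (F x + y) * indicator B (- F x) \<partial>?M)"
      by (subst trans[OF _ u(1), symmetric]) (simp_all add: add)
  qed
  also have "\<dots> = (\<integral>\<^sup>+x. \<integral>\<^sup>+y. indicator A (F x + y) * indicator B (- F x) \<partial>?M \<partial>?M)"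
    by (rule P.Fubini') measurable
  also have "\<dots> = (\<integral>\<^sup>+x. indicator {x. - F x \<in> B} x * emeasure ?M A \<partial>?M)"
  proof (rule nn_integral_cong_AE, rule eventually_mono[OF AE_lborel_Rn])
    fix x assume "x \<in> Rn n"
    then have "emeasure ?M A = (\<integral>\<^sup>+y. indicator A (y + F x) \<partial>?M)"
      unfolding em using maps by (intro trans[symmetric]) auto
    then show "(\<integral>\<^sup>+y. indicator A (F x + y) * indicator B (- F x) \<partial>?M) =
        indicator {x. - F x \<in> B} x * emeasure ?M A"
      by (subst nn_integral_multc) (auto simp: indicator_def add.commute)
  qed
  also have "\<dots> = emeasure ?M {x. - F x \<in> B} * emeasure ?M A"
    using mB by (simp add: nn_integral_multc)
  finally show ?thesis .
qed

section \<open>Volumes of simplices and polytopes\<close>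

lemma unit_ball_sets [measurable]: "unit_ball n \<in> sets borel"
proof -
  have "unit_ball n = Rn n \<inter> {x \<in> space borel. (\<Sum>i<n. (x i)\<^sup>2) \<le> 1}"
    by (auto simp: unit_ball_def)
  also have "\<dots> \<in> sets borel" by measurable
  finally show ?thesis .
qed

lemma emeasure_cube:
  assumes "0 \<le> a"
  shows "emeasure (lborel_Rn n) {x. \<forall>i<n. x i \<in> {- a..a}} = ennreal ((2 * a) ^ n)"
proof -
  have "emeasure (lborel_Rn n) {x. \<forall>i<n. x i \<in> {- a..a}} = (\<Prod>i<n. emeasure lborel {- a..a})"
    by (rule emeasure_lborel_Rn_box) simp
  also have "\<dots> = ennreal (2 * a) ^ n"
    using assms by simp
  also have "\<dots> = ennreal ((2 * a) ^ n)"
    using assms by (intro ennreal_power) simp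
  finally show ?thesis .
qed

lemma sets_cube: "{x :: nat \<Rightarrow> real. \<forall>i<n. x i \<in> {- a..a}} \<in> sets borel"
  by (rule sets_box) simp

text \<open>The ball contains the cube of half side \<open>1 / sqrt n\<close>.\<close>

lemma unit_ball_lower:
  assumes "n \<ge> 1"
  shows "ennreal ((2 / sqrt (real n)) ^ n) \<le> emeasure (lborel_Rn n) (unit_ball n)"
proof -
  let ?a = "1 / sqrt (real n)"
  \<comment> \<open>The inclusion holds only almost everywhere: the cube leaves the coordinates from
    n on free, while the ball lies in \<open>Rn n\<close>.\<close>
  have "AE x in lborel_Rn n. x \<in> {x. \<forall>i<n. x i \<in> {- ?a..?a}} \<longrightarrow> x \<in> unit_ball n"
    using AE_lborel_Rn[of n]
  proof eventually_elim
    case (elim x)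
    show ?case
    proof
      assume "x \<in> {x. \<forall>i<n. x i \<in> {- ?a..?a}}"
      then have le: "\<bar>x i\<bar> \<le> ?a" if "i < n" for i using that by (auto simp: abs_le_iff)
      have "(x i)\<^sup>2 \<le> 1 / real n" if "i < n" for i
        using power_mono[OF le[OF that], of 2] by (simp add: power_divide)
      then have "(\<Sum>i<n. (x i)\<^sup>2) \<le> (\<Sum>i<n. 1 / real n)" by (intro sum_mono) auto
      also have "\<dots> = 1" using assms by simp
      finally show "x \<in> unit_ball n" using elim by (simp add: unit_ball_def)
    qed
  qed
  then have "emeasure (lborel_Rn n) {x. \<forall>i<n. x i \<in> {- ?a..?a}} \<le> emeasure (lborel_Rn n) (unit_ball n)"
    by (rule emeasure_mono_AE) (simp add: sets_lborel_Rn)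
  then show ?thesis by (subst (asm) emeasure_cube) simp_all
qed

lemma unit_ball_finite: "emeasure (lborel_Rn n) (unit_ball n) < \<infinity>"
proof -
  have "unit_ball n \<subseteq> {x. \<forall>i<n. x i \<in> {- 1..1}}"
  proof
    fix x assume x: "x \<in> unit_ball n"
    have "\<bar>x i\<bar> \<le> 1" if "i < n" for i
    proof -
      have "(x i)\<^sup>2 \<le> (\<Sum>i<n. (x i)\<^sup>2)" using that by (intro member_le_sum) auto
      then have "(x i)\<^sup>2 \<le> 1" using x by (simp add: unit_ball_def)
      then show ?thesis by (simp add: abs_square_le_1)
    qed
    then show "x \<in> {x. \<forall>i<n. x i \<in> {- 1..1}}" by (auto simp: abs_le_iff)
  qed
  then have "emeasure (lborel_Rn n) (unit_ball n) \<le> emeasure (lborel_Rn n) {x. \<forall>i<n. x i \<in> {- 1..1}}"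
    using sets_cube by (intro emeasure_mono) (simp_all add: sets_lborel_Rn)
  also have "\<dots> < \<infinity>" by (subst emeasure_cube) simp_all
  finally show ?thesis .
qed

lemma unit_ball_pos: "0 < emeasure (lborel_Rn (Suc n)) (unit_ball (Suc n))"
proof -
  have "0 < ennreal ((2 / sqrt (real (Suc n))) ^ Suc n)" by (simp del: power_Suc)
  then show ?thesis by (rule less_le_trans[OF _ unit_ball_lower]) simp
qed

section \<open>Linear isometries and Householder reflections\<close>

lemma isometry_preserves_volume:
  assumes F [measurable]: "F \<in> borel_measurable borel"
    and add: "\<And>x y. F (x + y) = F x + F y"
    and maps: "\<And>x. x \<in> Rn (Suc n) \<Longrightarrow> F x \<in> Rn (Suc n)"
    and surj: "\<And>y. y \<in> Rn (Suc n) \<Longrightarrow> \<exists>x\<in>Rn (Suc n). F x = y"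
    and iso: "\<And>x. x \<in> Rn (Suc n) \<Longrightarrow> (\<Sum>i<Suc n. (F x i)\<^sup>2) = (\<Sum>i<Suc n. (x i)\<^sup>2)"
    and A [measurable]: "A \<in> sets borel"
  shows "emeasure (lborel_Rn (Suc n)) {x. F x \<in> A} = emeasure (lborel_Rn (Suc n)) A"
proof -
  let ?M = "lborel_Rn (Suc n)" and ?B = "unit_ball (Suc n)"
  have "{x. - F x \<in> ?B} \<in> sets ?M"
    using measurable_sets[of "\<lambda>x. - F x" ?M borel ?B] by (simp add: vimage_def)
  then have "emeasure ?M {x. - F x \<in> ?B} = emeasure ?M ?B"
  proof (rule emeasure_eq_AE[rotated])
    show "?B \<in> sets ?M" by (simp add: sets_lborel_Rn)
    show "AE x in ?M. (x \<in> {x. - F x \<in> ?B}) = (x \<in> ?B)"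
      using AE_lborel_Rn[of "Suc n"]
    proof eventually_elim
      case (elim x)
      then have "- F x \<in> Rn (Suc n)" using maps subspace_neg[OF subspace_Rn] by blast
      then show ?case using iso[OF elim] elim by (simp add: unit_ball_def)
    qed
  qed
  \<comment> \<open>Uniqueness of Haar measure is applied with the ball as second set. An isometry
    preserves the ball, whose volume is positive and finite and therefore cancels.\<close>
  then have "emeasure ?M ?B * emeasure ?M {x. F x \<in> A} = emeasure ?M ?B * emeasure ?M A"
    using haar_uniqueness[OF F add maps surj A, of ?B] by (simp add: mult.commute)
  then show ?thesis
    using unit_ball_finite[of "Suc n"] unit_ball_pos[of n]
    by (auto simp: ennreal_mult_cancel_left)
qed

text \<open>The reflection in the hyperplane orthogonal to w, which need not have length 1. If the
  first m entries of w vanish, the quotient is 0 by convention and the map is the identity.\<close>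

definition householder :: "nat \<Rightarrow> (nat \<Rightarrow> real) \<Rightarrow> (nat \<Rightarrow> real) \<Rightarrow> nat \<Rightarrow> real"
  where "householder m w x = x - (2 * (\<Sum>i<m. w i * x i) / (\<Sum>i<m. (w i)\<^sup>2)) *\<^sub>R w"

lemma householder_add: "householder m w (x + y) = householder m w x + householder m w y"
  by (simp add: householder_def distrib_left sum.distrib add_divide_distrib scaleR_left_distrib)

lemma householder_scaleR: "householder m w (c *\<^sub>R x) = c *\<^sub>R householder m w x"
proof -
  have "(\<Sum>i<m. w i * (c *\<^sub>R x) i) = c * (\<Sum>i<m. w i * x i)"
    by (simp add: sum_distrib_left mult_ac)
  then show ?thesis by (simp add: householder_def scaleR_right_diff_distrib mult_ac)
qed

lemma householder_in_Rn: "w \<in> Rn m \<Longrightarrow> x \<in> Rn m \<Longrightarrow> householder m w x \<in> Rn m"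
  by (auto simp: householder_def mem_Rn)

lemma householder_measurable: "householder m w \<in> borel_measurable borel"
  unfolding householder_def by measurable

lemma
  assumes w: "(\<Sum>i<m. (w i)\<^sup>2) \<noteq> 0"
  shows householder_involution: "householder m w (householder m w x) = x"
    and householder_isometry: "(\<Sum>i<m. (householder m w x i)\<^sup>2) = (\<Sum>i<m. (x i)\<^sup>2)"
proof -
  define W where "W = (\<Sum>i<m. (w i)\<^sup>2)"
  define p where "p = (\<Sum>i<m. w i * x i)"
  define a where "a = 2 * p / W"
  have h: "householder m w x = x - a *\<^sub>R w"
    by (simp add: householder_def a_def p_def W_def)
  have W: "W \<noteq> 0" using w by (simp add: W_def)
  \<comment> \<open>The reflection reverses the inner product with w, so the second application adds
    back what the first one subtracted.\<close>
  have "(\<Sum>i<m. w i * (x - a *\<^sub>R w) i) = p - a * W"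
    by (simp add: p_def W_def right_diff_distrib sum_subtractf sum_distrib_left power2_eq_square mult_ac)
  also have "\<dots> = - p" using W by (simp add: a_def)
  finally have "householder m w (x - a *\<^sub>R w) = x - a *\<^sub>R w - (2 * - p / W) *\<^sub>R w"
    by (simp add: householder_def W_def)
  then show "householder m w (householder m w x) = x"
    by (simp add: h a_def)
  have "(\<Sum>i<m. (householder m w x i)\<^sup>2) = (\<Sum>i<m. (x i)\<^sup>2 + (- 2 * a) * (w i * x i) + a\<^sup>2 * (w i)\<^sup>2)"
    unfolding h by (intro sum.cong) (auto simp: power2_eq_square algebra_simps)
  also have "\<dots> = (\<Sum>i<m. (x i)\<^sup>2) + (- 2 * a) * p + a\<^sup>2 * W"
    unfolding sum.distrib sum_distrib_left[symmetric] p_def W_def ..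
  also have "\<dots> = (\<Sum>i<m. (x i)\<^sup>2)"
    using W by (simp add: a_def power2_eq_square field_simps)
  finally show "(\<Sum>i<m. (householder m w x i)\<^sup>2) = (\<Sum>i<m. (x i)\<^sup>2)" .
qed

text \<open>The n vectors form a matrix with n + 1 columns, and these columns lie in dimension n.
  The coefficients of a linear relation between the columns, normalised, are a unit normal.\<close>

lemma exists_normal:
  assumes z: "\<And>i. i < n \<Longrightarrow> z i \<in> Rn (Suc n)"
  obtains v where "v \<in> Rn (Suc n)" "(\<Sum>j<Suc n. (v j)\<^sup>2) = 1"
    "\<And>i. i < n \<Longrightarrow> (\<Sum>j<Suc n. v j * z i j) = 0"
proof -
  define Z where "Z = (\<lambda>j i. if i < n then z i j else 0)"
  have Z: "\<And>j. Z j \<in> Rn n" by (simp add: Z_def mem_Rn)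
  obtain c where c: "\<exists>j\<in>{..<Suc n}. c j \<noteq> 0" "(\<Sum>j<Suc n. c j *\<^sub>R Z j) = 0"
    using linear_relation[of "{..<Suc n}" n Z] Z by (metis card_lessThan finite_lessThan lessI)
  define N where "N = L2_set c {..<Suc n}"
  define v where "v = (\<lambda>j. if j < Suc n then c j / N else 0)"
  have N: "N > 0"
  proof -
    have "N \<noteq> 0" unfolding N_def using c(1) L2_set_eq_0_iff[OF finite_lessThan, of c "Suc n"] by blast
    then show ?thesis using L2_set_nonneg[of c "{..<Suc n}"] N_def by linarith
  qed
  show ?thesis
  proof (rule that[of v])
    show "v \<in> Rn (Suc n)" by (simp add: v_def mem_Rn)
    have "(\<Sum>j<Suc n. (v j)\<^sup>2) = (\<Sum>j<Suc n. (c j)\<^sup>2) / N\<^sup>2"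
      unfolding sum_divide_distrib by (intro sum.cong) (auto simp: v_def power_divide)
    also have "(\<Sum>j<Suc n. (c j)\<^sup>2) = N\<^sup>2"
      unfolding N_def L2_set_def by (subst real_sqrt_pow2) (simp_all add: sum_nonneg del: sum.lessThan_Suc)
    finally show "(\<Sum>j<Suc n. (v j)\<^sup>2) = 1" using N by simp
    fix i assume i: "i < n"
    have "(\<Sum>j<Suc n. v j * z i j) = (\<Sum>j<Suc n. c j * z i j) / N"
      unfolding sum_divide_distrib by (intro sum.cong) (auto simp: v_def)
    also have "(\<Sum>j<Suc n. c j * z i j) = (\<Sum>j<Suc n. c j *\<^sub>R Z j) i"
      unfolding sum_fun_apply Z_def using i by simp
    also have "\<dots> = 0" unfolding c(2) by simp
    finally show "(\<Sum>j<Suc n. v j * z i j) = 0" by simp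
  qed
qed

lemma Rn_Suc_drop: "x \<in> Rn (Suc n) \<Longrightarrow> x n = 0 \<Longrightarrow> x \<in> Rn n"
  unfolding mem_Rn by (metis Suc_leI le_neq_implies_less)

text \<open>Let v be a unit normal to all \<open>z i\<close>. The reflection that exchanges v with
  the last unit vector carries the hyperplane orthogonal to v, and with it every \<open>z i\<close>,
  into \<open>Rn n\<close>.\<close>

lemma flattening_isometry:
  assumes z: "\<And>i. i < n \<Longrightarrow> z i \<in> Rn (Suc n)"
  obtains F where "F \<in> borel_measurable borel" "\<And>x y. F (x + y) = F x + F y" "\<And>c x. F (c *\<^sub>R x) = c *\<^sub>R F x"
    "\<And>x. x \<in> Rn (Suc n) \<Longrightarrow> F x \<in> Rn (Suc n)"
    "\<And>y. y \<in> Rn (Suc n) \<Longrightarrow> \<exists>x\<in>Rn (Suc n). F x = y"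
    "\<And>x. x \<in> Rn (Suc n) \<Longrightarrow> (\<Sum>i<Suc n. (F x i)\<^sup>2) = (\<Sum>i<Suc n. (x i)\<^sup>2)"
    "\<And>i. i < n \<Longrightarrow> F (z i) \<in> Rn n"
proof -
  obtain v where v: "v \<in> Rn (Suc n)" "(\<Sum>j<Suc n. (v j)\<^sup>2) = 1"
    "\<And>i. i < n \<Longrightarrow> (\<Sum>j<Suc n. v j * z i j) = 0"
    using exists_normal[of n z] z by blast
  define w where "w = v - unit_vec n"
  have sum_w: "(\<Sum>j<Suc n. w j * x j) = (\<Sum>j<Suc n. v j * x j) - x n" for x
    unfolding w_def by (simp add: left_diff_distrib sum_subtractf)
  have w: "w \<in> Rn (Suc n)" unfolding w_def using v(1) by (auto simp: mem_Rn)
  \<comment> \<open>This squared length vanishes exactly if v is already the last unit vector; that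
    case needs no reflection and is treated separately below.\<close>
  have W: "(\<Sum>j<Suc n. (w j)\<^sup>2) = 2 - 2 * v n"
  proof -
    have "(\<Sum>j<Suc n. (w j)\<^sup>2) = (\<Sum>j<Suc n. w j * w j)" by (simp add: power2_eq_square)
    also have "\<dots> = (\<Sum>j<Suc n. w j * v j) - w n"
      using sum_w[of w] by (simp only: mult.commute)
    also have "\<dots> = (\<Sum>j<Suc n. (v j)\<^sup>2) - v n - w n"
      using sum_w[of v] by (simp only: power2_eq_square)
    finally show ?thesis using v(2) by (simp add: w_def)
  qed
  show ?thesis
  proof (cases "v n = 1")
    case False
    then have W0: "(\<Sum>j<Suc n. (w j)\<^sup>2) \<noteq> 0" using W by simp
    let ?H = "householder (Suc n) w"
    show ?thesis
    proof (rule that[of ?H])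
      show "\<exists>x\<in>Rn (Suc n). ?H x = y" if "y \<in> Rn (Suc n)" for y
        using householder_involution[OF W0, of y] householder_in_Rn[OF w that] by blast
      show "?H (z i) \<in> Rn n" if i: "i < n" for i
      proof -
        have "(\<Sum>j<Suc n. w j * z i j) = - z i n" unfolding sum_w using v(3)[OF i] by simp
        then have "?H (z i) n = z i n - (2 * (- z i n) / (2 - 2 * v n)) * w n"
          unfolding householder_def using W by simp
        also have "\<dots> = 0" using False by (simp add: w_def field_simps)
        finally have "?H (z i) n = 0" .
        moreover have "?H (z i) \<in> Rn (Suc n)" using householder_in_Rn[OF w z[OF i]] .
        ultimately show ?thesis by (rule Rn_Suc_drop[rotated])
      qed
    qed (use householder_add householder_scaleR householder_measurable householder_in_Rn[OF w] householder_isometry[OF W0] in blast)+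
  next
    case True
    then have "(\<Sum>j<n. (v j)\<^sup>2) = 0" using v(2) by simp
    then have "\<And>j. j < n \<Longrightarrow> v j = 0" by (simp add: sum_nonneg_eq_0_iff)
    then have "z i n = 0" if "i < n" for i using v(3)[OF that] True by simp
    then have "z i \<in> Rn n" if "i < n" for i
      using that z by (blast intro: Rn_Suc_drop)
    then show ?thesis by (intro that[of "\<lambda>x. x"]) auto
  qed
qed

section \<open>Simplices with a vertex at the origin: the cone formula and Hadamard's
  inequality\<close>

definition corner_simplex :: "nat \<Rightarrow> (nat \<Rightarrow> nat \<Rightarrow> real) \<Rightarrow> (nat \<Rightarrow> real) set"
  where "corner_simplex n z =
    {(\<Sum>i<n. t i *\<^sub>R z i) | t. (\<forall>i<n. 0 \<le> t i) \<and> (\<Sum>i<n. t i) \<le> 1}"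

text \<open>The slice of a cone at relative height \<open>h / a\<close> is the base scaled by
  \<open>1 - h / a\<close>. Integrating the n-th power of this ratio gives the factor in the volume
  formula height times base over n + 1.\<close>

lemma nn_integral_cone_profile:
  assumes "a \<noteq> 0"
  shows "(\<integral>\<^sup>+h. ennreal ((1 - h / a) ^ n) * indicator {0..1} (h / a) \<partial>lborel) = ennreal (\<bar>a\<bar> / (n + 1))"
proof -
  have "(\<integral>\<^sup>+h. ennreal ((1 - h / a) ^ n) * indicator {0..1} (h / a) \<partial>lborel) =
      \<bar>a\<bar> * (\<integral>\<^sup>+u. ennreal ((1 - (0 + a * u) / a) ^ n) * indicator {0..1} ((0 + a * u) / a) \<partial>lborel)"
    using assms by (intro nn_integral_real_affine) measurable
  also have "(\<integral>\<^sup>+u. ennreal ((1 - (0 + a * u) / a) ^ n) * indicator {0..1} ((0 + a * u) / a) \<partial>lborel) =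
      (\<integral>\<^sup>+u. ennreal ((1 - u) ^ n) * indicator {0..1} u \<partial>lborel)"
    using assms by simp
  also have "\<dots> = ennreal (- ((1 - 1) ^ Suc n / real (Suc n)) - - ((1 - 0) ^ Suc n / real (Suc n)))"
  proof (rule nn_integral_FTC_Icc)
    show "((\<lambda>u. - ((1 - u) ^ Suc n / real (Suc n))) has_real_derivative (1 - x) ^ n) (at x)" for x
    proof -
      have "((\<lambda>u. (1 - u) ^ Suc n) has_real_derivative real (Suc n) * (1 - x) ^ n * - 1) (at x)"
        by (rule derivative_eq_intros refl | simp)+
      from DERIV_minus[OF DERIV_cdivide[OF this, of "real (Suc n)"]] show ?thesis
        by (rule DERIV_cong) simp
    qed
  qed auto
  also have "ennreal \<bar>a\<bar> * \<dots> = ennreal (\<bar>a\<bar> / (n + 1))"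
    by (subst ennreal_mult[symmetric]) (auto simp: add.commute)
  finally show ?thesis .
qed

lemma hyperplane_null: "emeasure (lborel_Rn (Suc n)) {x. x n = a} = 0"
proof -
  have m: "{x :: nat \<Rightarrow> real. x n = a} \<in> sets borel"
    using measurable_sets[of "\<lambda>x :: nat \<Rightarrow> real. x n" borel borel "{a}"] by (simp add: vimage_def)
  then have "emeasure (lborel_Rn (Suc n)) {x. x n = a} = (\<integral>\<^sup>+x. indicator {x. x n = a} x \<partial>lborel_Rn (Suc n))"
    by (simp add: sets_lborel_Rn)
  also have "\<dots> = (\<integral>\<^sup>+h. \<integral>\<^sup>+x. indicator {x. x n = a} (x(n := h)) \<partial>lborel_Rn n \<partial>lborel)"
    using m by (intro nn_integral_lborel_Rn_Suc) simp
  also have "\<dots> = (\<integral>\<^sup>+h. 0 \<partial>(lborel :: real measure))"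
    using AE_lborel_singleton[of a]
    by (intro nn_integral_cong_AE) (auto elim!: eventually_mono)
  finally show ?thesis by simp
qed

text \<open>The simplex is the cone with apex \<open>z n\<close> over a simplex in
  \<open>Rn n\<close>. Each slice is a translate of a scaled copy of the base, and the slices are
  integrated over the height. An apex in the base hyperplane gives a null set.\<close>

lemma cone_volume:
  assumes z: "\<And>i. i < n \<Longrightarrow> z i \<in> Rn n" and w: "z n \<in> Rn (Suc n)"
    and C0 [measurable]: "C0 \<in> sets borel" and sub: "corner_simplex n z \<subseteq> C0"
  obtains C where "C \<in> sets borel" "corner_simplex (Suc n) z \<subseteq> C"
    "emeasure (lborel_Rn (Suc n)) C \<le> ennreal (\<bar>z n n\<bar> / (n + 1)) * emeasure (lborel_Rn n) C0"
proof (cases "z n n = 0")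
  case True
  let ?C = "{x :: nat \<Rightarrow> real. x n = 0}"
  have "?C \<in> sets borel"
    using measurable_sets[of "\<lambda>x :: nat \<Rightarrow> real. x n" borel borel "{0}"] by (simp add: vimage_def)
  moreover have "corner_simplex (Suc n) z \<subseteq> ?C"
    using z True by (auto simp: corner_simplex_def mem_Rn)
  ultimately show ?thesis using that[of ?C] hyperplane_null[of n 0] by simp
next
  case False
  define a where "a = z n n"
  define w' where "w' = (z n)(n := 0)"
  have a: "a \<noteq> 0" using False by (simp add: a_def)
  have w': "w' \<in> Rn n" using w by (auto simp: w'_def mem_Rn)
  \<comment> \<open>Central projection from the apex to the base: with \<open>t = x n / a\<close>,
    the point x is t times the apex plus \<open>1 - t\<close> times \<open>g x\<close>.\<close>
  define g where "g = (\<lambda>x :: nat \<Rightarrow> real. (1 / (1 - x n / a)) *\<^sub>R (x(n := 0) - (x n / a) *\<^sub>R w'))"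
  \<comment> \<open>The height of the apex is left out since g divides by
    \<open>1 - x n / a\<close>; the null hyperplane \<open>?H\<close> takes care of it.\<close>
  define P where "P = {x. x n / a \<in> {0..<1} \<and> g x \<in> C0}"
  have g [measurable]: "g \<in> borel_measurable borel" unfolding g_def by measurable
  have P [measurable]: "P \<in> sets borel"
  proof -
    have "P = {x \<in> space borel. x n / a \<in> {0..<1}} \<inter> (g -` C0 \<inter> space borel)" by (auto simp: P_def)
    also have "\<dots> \<in> sets borel" by measurable
    finally show ?thesis .
  qed
  let ?H = "{x :: nat \<Rightarrow> real. x n = a}"
  have H: "?H \<in> sets borel"
    using measurable_sets[of "\<lambda>x :: nat \<Rightarrow> real. x n" borel borel "{a}"] by (simp add: vimage_def)
  have simplex: "corner_simplex (Suc n) z \<subseteq> ?H \<union> P"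
  proof
    fix x assume "x \<in> corner_simplex (Suc n) z"
    then obtain t where t: "\<And>i. i < Suc n \<Longrightarrow> 0 \<le> t i" "(\<Sum>i<Suc n. t i) \<le> 1"
      and x: "x = (\<Sum>i<Suc n. t i *\<^sub>R z i)"
      unfolding corner_simplex_def by blast
    have "x n = t n * a" using z by (simp add: x a_def mem_Rn)
    then have xn: "x n / a = t n" using a by simp
    have "(\<Sum>i<n. t i) \<ge> 0" using t(1) by (intro sum_nonneg) auto
    then have tn: "t n \<le> 1" using t(2) by simp
    show "x \<in> ?H \<union> P"
    proof (cases "t n = 1")
      case True
      then show ?thesis using \<open>x n = t n * a\<close> by simp
    next
      case False
      then have lt: "t n < 1" using tn by simp
      have "x(n := 0) - t n *\<^sub>R w' = (\<Sum>i<n. t i *\<^sub>R z i)"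
        using z by (auto simp: fun_eq_iff x w'_def mem_Rn)
      then have "g x = (\<Sum>i<n. (1 / (1 - t n) * t i) *\<^sub>R z i)"
        unfolding g_def xn by (simp only: scaleR_sum_right scaleR_scaleR)
      moreover have "(\<Sum>i<n. 1 / (1 - t n) * t i) \<le> 1"
        using t(2) lt by (simp add: sum_divide_distrib[symmetric] field_simps)
      ultimately have "g x \<in> corner_simplex n z"
        unfolding corner_simplex_def using t(1) lt
        by (intro CollectI exI[of _ "\<lambda>i. 1 / (1 - t n) * t i"]) auto
      then show ?thesis using sub xn lt t(1) by (auto simp: P_def)
    qed
  qed
  have slice: "(\<integral>\<^sup>+x. indicator P (x(n := h)) \<partial>lborel_Rn n) \<le>
      ennreal ((1 - h / a) ^ n) * indicator {0..1} (h / a) * emeasure (lborel_Rn n) C0" for h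
  proof (cases "h / a \<in> {0..<1}")
    case False
    then have "x(n := h) \<notin> P" for x by (auto simp: P_def)
    then show ?thesis by simp
  next
    case True
    define t where "t = h / a"
    have t: "0 \<le> t" "t < 1" using True by (auto simp: t_def)
    \<comment> \<open>At height h the projection g is the affine map with these
      coefficients.\<close>
    let ?v = "(- (t / (1 - t))) *\<^sub>R w'" and ?c = "1 / (1 - t)"
    have v: "?v \<in> Rn n" using w' subspace_scale[OF subspace_Rn] by blast
    have m: "{x. ?v + ?c *\<^sub>R x \<in> C0} \<in> sets (lborel_Rn n)"
      using measurable_sets[of "\<lambda>x. ?v + ?c *\<^sub>R x" "lborel_Rn n" borel C0] by (simp add: vimage_def)
    have "(\<integral>\<^sup>+x. indicator P (x(n := h)) \<partial>lborel_Rn n) =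
        (\<integral>\<^sup>+x. indicator {x. ?v + ?c *\<^sub>R x \<in> C0} x \<partial>lborel_Rn n)"
    proof (rule nn_integral_cong_AE, rule eventually_mono[OF AE_lborel_Rn])
      fix x assume "x \<in> Rn n"
      then have "x(n := 0) = x" by (auto simp: mem_Rn)
      then have "g (x(n := h)) = ?v + ?c *\<^sub>R x"
        unfolding g_def by (simp add: t_def[symmetric] fun_eq_iff algebra_simps)
      then show "indicator P (x(n := h)) = (indicator {x. ?v + ?c *\<^sub>R x \<in> C0} x :: ennreal)"
        using t by (auto simp: P_def indicator_def t_def)
    qed
    also have "\<dots> = emeasure (lborel_Rn n) {x. ?v + ?c *\<^sub>R x \<in> C0}"
      using m by (rule nn_integral_indicator)
    \<comment> \<open>The inserted factors multiply to 1; the second one together with the measure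
      is the change of variables for C0.\<close>
    also have "\<dots> = ennreal ((1 - t) ^ n) * (ennreal (\<bar>?c\<bar> ^ n) * emeasure (lborel_Rn n) {x. ?v + ?c *\<^sub>R x \<in> C0})"
      using t by (simp add: mult.assoc[symmetric] ennreal_mult[symmetric] power_mult_distrib[symmetric])
    also have "\<dots> = ennreal ((1 - t) ^ n) * emeasure (lborel_Rn n) C0"
      using emeasure_lborel_Rn_affine_vimage[OF C0 _ v, of ?c] t by simp
    finally show ?thesis using t by (simp add: t_def)
  qed
  have "emeasure (lborel_Rn (Suc n)) P = (\<integral>\<^sup>+x. indicator P x \<partial>lborel_Rn (Suc n))"
    by (simp add: sets_lborel_Rn)
  also have "\<dots> = (\<integral>\<^sup>+h. \<integral>\<^sup>+x. indicator P (x(n := h)) \<partial>lborel_Rn n \<partial>lborel)"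
    by (intro nn_integral_lborel_Rn_Suc) measurable
  also have "\<dots> \<le> (\<integral>\<^sup>+h. ennreal ((1 - h / a) ^ n) * indicator {0..1} (h / a) * emeasure (lborel_Rn n) C0 \<partial>lborel)"
    by (intro nn_integral_mono slice)
  also have "\<dots> = ennreal (\<bar>a\<bar> / (n + 1)) * emeasure (lborel_Rn n) C0"
    unfolding nn_integral_cone_profile[OF a, of n, symmetric] by (rule nn_integral_multc) measurable
  finally have "emeasure (lborel_Rn (Suc n)) P \<le> ennreal (\<bar>a\<bar> / (n + 1)) * emeasure (lborel_Rn n) C0" .
  moreover have "emeasure (lborel_Rn (Suc n)) (?H \<union> P) \<le> emeasure (lborel_Rn (Suc n)) ?H + emeasure (lborel_Rn (Suc n)) P"
    using H by (intro emeasure_subadditive) (auto simp: sets_lborel_Rn)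
  ultimately have "emeasure (lborel_Rn (Suc n)) (?H \<union> P) \<le> ennreal (\<bar>a\<bar> / (n + 1)) * emeasure (lborel_Rn n) C0"
    by (simp add: hyperplane_null)
  then show ?thesis using that[of "?H \<union> P"] H P simplex by (auto simp: a_def)
qed

text \<open>Hadamard's inequality for simplices, stated for a Borel superset to avoid proving that the
  simplex itself is Borel.\<close>

lemma hadamard_simplex:
  assumes "\<And>i. i < n \<Longrightarrow> z i \<in> Rn n"
  shows "\<exists>C\<in>sets borel. corner_simplex n z \<subseteq> C \<and>
    emeasure (lborel_Rn n) C \<le> ennreal ((\<Prod>i<n. L2_set (z i) {..<n}) / fact n)"
  using assms
proof (induction n arbitrary: z)
  case 0
  have "emeasure (lborel_Rn 0) UNIV = (\<integral>\<^sup>+x. 1 \<partial>lborel_Rn 0)" by simp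
  also have "\<dots> = 1" by (rule nn_integral_lborel_Rn_0) simp
  finally show ?case by (intro bexI[of _ UNIV]) auto
next
  case (Suc n)
  have zn: "\<And>i. i < n \<Longrightarrow> z i \<in> Rn (Suc n)" using Suc.prems by simp
  \<comment> \<open>An isometry moves the first n vectors into \<open>Rn n\<close>, so that the
    simplex becomes a cone over a simplex of one dimension less.\<close>
  obtain F where F [measurable]: "F \<in> borel_measurable borel" and add: "\<And>x y. F (x + y) = F x + F y"
    and scale: "\<And>c x. F (c *\<^sub>R x) = c *\<^sub>R F x"
    and maps: "\<And>x. x \<in> Rn (Suc n) \<Longrightarrow> F x \<in> Rn (Suc n)"
    and surj: "\<And>y. y \<in> Rn (Suc n) \<Longrightarrow> \<exists>x\<in>Rn (Suc n). F x = y"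
    and iso: "\<And>x. x \<in> Rn (Suc n) \<Longrightarrow> (\<Sum>i<Suc n. (F x i)\<^sup>2) = (\<Sum>i<Suc n. (x i)\<^sup>2)"
    and flat: "\<And>i. i < n \<Longrightarrow> F (z i) \<in> Rn n"
    using flattening_isometry[of n z] zn by blast
  have L2: "L2_set (F x) {..<Suc n} = L2_set x {..<Suc n}" if "x \<in> Rn (Suc n)" for x
    unfolding L2_set_def using iso[OF that] by simp
  have L2n: "L2_set (F (z i)) {..<n} = L2_set (z i) {..<Suc n}" if "i < n" for i
  proof -
    have "L2_set (F (z i)) {..<n} = L2_set (F (z i)) {..<Suc n}"
      unfolding L2_set_def using flat[OF that] by (simp add: mem_Rn)
    then show ?thesis using L2 Suc.prems that by simp
  qed
  define y where "y = (\<lambda>i. F (z i))"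
  obtain C0 where C0: "C0 \<in> sets borel" "corner_simplex n y \<subseteq> C0"
    "emeasure (lborel_Rn n) C0 \<le> ennreal ((\<Prod>i<n. L2_set (y i) {..<n}) / fact n)"
    using Suc.IH[of y] flat unfolding y_def by blast
  have "y n \<in> Rn (Suc n)" using maps Suc.prems by (simp add: y_def)
  from cone_volume[of n y, OF _ this C0(1,2)]
  obtain C where C [measurable]: "C \<in> sets borel" and sub: "corner_simplex (Suc n) y \<subseteq> C"
    and em: "emeasure (lborel_Rn (Suc n)) C \<le> ennreal (\<bar>y n n\<bar> / (n + 1)) * emeasure (lborel_Rn n) C0"
    using flat by (auto simp: y_def)
  let ?D = "{x. F x \<in> C}"
  have D: "?D \<in> sets borel"
    using measurable_sets[of F borel borel C] by (simp add: vimage_def)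
  have F0: "F 0 = 0" using scale[of 0 0] by simp
  have Fsum: "F (\<Sum>i<m. t i *\<^sub>R z i) = (\<Sum>i<m. t i *\<^sub>R y i)" for m t
    by (induction m) (simp_all add: add scale F0 y_def
        del: sum_fun_apply scaleR_fun_apply plus_fun_apply zero_fun_apply)
  have "corner_simplex (Suc n) z \<subseteq> ?D"
  proof
    fix x assume "x \<in> corner_simplex (Suc n) z"
    then have "F x \<in> corner_simplex (Suc n) y"
      unfolding corner_simplex_def using Fsum by blast
    then show "x \<in> ?D" using sub by blast
  qed
  moreover have "emeasure (lborel_Rn (Suc n)) ?D \<le> ennreal ((\<Prod>i<Suc n. L2_set (z i) {..<Suc n}) / fact (Suc n))"
  proof -
    have "emeasure (lborel_Rn (Suc n)) ?D = emeasure (lborel_Rn (Suc n)) C"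
      by (rule isometry_preserves_volume[OF F add maps surj iso C])
    also have "\<dots> \<le> ennreal (\<bar>y n n\<bar> / (n + 1)) * ennreal ((\<Prod>i<n. L2_set (y i) {..<n}) / fact n)"
      using em C0(3) by (meson mult_left_mono order_trans zero_le)
    also have "\<dots> = ennreal (\<bar>F (z n) n\<bar> / (n + 1) * ((\<Prod>i<n. L2_set (z i) {..<Suc n}) / fact n))"
      by (subst ennreal_mult[symmetric]) (auto simp: L2n y_def intro!: divide_nonneg_nonneg prod_nonneg)
    \<comment> \<open>The height of the apex above the base is at most its length.\<close>
    also have "\<dots> \<le> ennreal (L2_set (z n) {..<Suc n} / (n + 1) * ((\<Prod>i<n. L2_set (z i) {..<Suc n}) / fact n))"
    proof (intro ennreal_leI mult_right_mono divide_right_mono)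
      show "\<bar>F (z n) n\<bar> \<le> L2_set (z n) {..<Suc n}"
        using member_le_L2_set[of "{..<Suc n}" n "\<lambda>i. \<bar>F (z n) i\<bar>"] L2[of "z n"] Suc.prems
        by (simp add: L2_set_def)
    qed (auto intro!: prod_nonneg divide_nonneg_nonneg)
    also have "\<dots> = ennreal ((\<Prod>i<Suc n. L2_set (z i) {..<Suc n}) / fact (Suc n))"
      by (simp add: field_simps)
    finally show ?thesis .
  qed
  ultimately show ?case using D by blast
qed

section \<open>Elementary symmetric sums and coverings by simplices\<close>

lemma power_add_ge_two_terms:
  fixes a b :: real
  assumes "0 \<le> a" "0 \<le> b"
  shows "a ^ Suc m + real (Suc m) * b * a ^ m \<le> (a + b) ^ Suc m"
proof (induction m)
  case (Suc m)
  have "a ^ Suc (Suc m) + real (Suc (Suc m)) * b * a ^ Suc m \<le>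
      (a + b) * (a ^ Suc m + real (Suc m) * b * a ^ m)"
    using assms by (simp add: algebra_simps)
  also have "\<dots> \<le> (a + b) * (a + b) ^ Suc m"
    using Suc.IH assms by (intro mult_left_mono) auto
  finally show ?case by simp
qed simp

text \<open>In the expanded power of the sum, the product over each n-element subset occurs
  \<open>fact n\<close> times. The proof is by induction on J, separating the subsets that contain
  the new element. The division by \<open>fact n\<close> yields the second factorial in the volume
  bound.\<close>

lemma sum_prod_subsets_le:
  fixes f :: "'i \<Rightarrow> real"
  assumes "finite J" "\<And>j. j \<in> J \<Longrightarrow> 0 \<le> f j"
  shows "(\<Sum>I | I \<subseteq> J \<and> card I = n. \<Prod>i\<in>I. f i) \<le> (\<Sum>j\<in>J. f j) ^ n / fact n"
  using assms
proof (induction J arbitrary: n rule: finite_induct)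
  case empty
  show ?case
  proof (cases n)
    case 0
    have "{I :: 'i set. I \<subseteq> {} \<and> card I = n} = {{}}" using 0 by auto
    then show ?thesis using 0 by simp
  next
    case (Suc m)
    then have "{I :: 'i set. I \<subseteq> {} \<and> card I = n} = {}" by auto
    then show ?thesis by (simp only: sum.empty) simp
  qed
next
  case (insert x J)
  let ?S = "\<Sum>j\<in>J. f j"
  have nonneg: "0 \<le> ?S" "0 \<le> f x" using insert.prems by (auto intro: sum_nonneg)
  show ?case
  proof (cases n)
    case 0
    have "{I. I \<subseteq> insert x J \<and> card I = n} = {{}}"
      using 0 insert.hyps(1) by (auto dest: finite_subset)
    then show ?thesis using 0 by simp
  next
    case (Suc m)
    let ?A = "\<lambda>k. {I. I \<subseteq> J \<and> card I = k}"
    have fin: "finite (?A k)" for k using insert.hyps(1) by simp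
    have split: "{I. I \<subseteq> insert x J \<and> card I = Suc m} = ?A (Suc m) \<union> Set.insert x ` ?A m"
    proof (intro equalityI subsetI)
      fix I assume I: "I \<in> {I. I \<subseteq> insert x J \<and> card I = Suc m}"
      show "I \<in> ?A (Suc m) \<union> Set.insert x ` ?A m"
      proof (cases "x \<in> I")
        case True
        then have "I = Set.insert x (I - {x})" "I - {x} \<in> ?A m"
          using I by (auto simp: card_Diff_singleton_if)
        then show ?thesis by blast
      qed (use I in auto)
    next
      fix I assume "I \<in> ?A (Suc m) \<union> Set.insert x ` ?A m"
      then show "I \<in> {I. I \<subseteq> insert x J \<and> card I = Suc m}"
      proof
        assume "I \<in> Set.insert x ` ?A m"
        then obtain I' where "I = Set.insert x I'" "I' \<subseteq> J" "card I' = m" by auto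
        then show ?thesis using insert.hyps finite_subset[of I' J] by (auto simp: card_insert_if)
      qed auto
    qed
    have inj: "inj_on (Set.insert x) (?A m)"
      using insert.hyps(2) by (auto simp: inj_on_def)
    have prod: "(\<Prod>i\<in>Set.insert x I. f i) = f x * (\<Prod>i\<in>I. f i)" if "I \<in> ?A m" for I
      using that insert.hyps finite_subset[of I J] by (subst prod.insert) auto
    have "(\<Sum>I | I \<subseteq> insert x J \<and> card I = n. \<Prod>i\<in>I. f i) =
        (\<Sum>I\<in>?A (Suc m). \<Prod>i\<in>I. f i) + (\<Sum>I\<in>Set.insert x ` ?A m. \<Prod>i\<in>I. f i)"
      unfolding Suc split using fin insert.hyps(2) by (intro sum.union_disjoint) auto
    also have "(\<Sum>I\<in>Set.insert x ` ?A m. \<Prod>i\<in>I. f i) = f x * (\<Sum>I\<in>?A m. \<Prod>i\<in>I. f i)"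
      unfolding sum.reindex[OF inj] sum_distrib_left using prod by (intro sum.cong) auto
    also have "(\<Sum>I\<in>?A (Suc m). \<Prod>i\<in>I. f i) + f x * (\<Sum>I\<in>?A m. \<Prod>i\<in>I. f i) \<le>
        ?S ^ Suc m / fact (Suc m) + f x * (?S ^ m / fact m)"
      using insert.prems nonneg by (intro add_mono mult_left_mono insert.IH) auto
    also have "\<dots> = (?S ^ Suc m + real (Suc m) * f x * ?S ^ m) / fact (Suc m)"
      by (simp add: add_divide_distrib mult.assoc del: power_Suc of_nat_Suc)
    \<comment> \<open>The numerator consists of the first two terms of the binomial
      expansion.\<close>
    also have "\<dots> \<le> (?S + f x) ^ Suc m / fact (Suc m)"
      using power_add_ge_two_terms[OF nonneg, of m] by (intro divide_right_mono) auto
    finally show ?thesis using insert.hyps by (simp add: Suc add.commute)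
  qed
qed

text \<open>For finite J this is the convex hull of 0 and the points \<open>z j\<close>. An indexed
  family is used so that coinciding points remain distinct when n-element subsets are summed
  over.\<close>

definition subconvex_combinations :: "'i set \<Rightarrow> ('i \<Rightarrow> 'a::real_vector) \<Rightarrow> 'a set"
  where "subconvex_combinations J z =
    {(\<Sum>j\<in>J. t j *\<^sub>R z j) | t. (\<forall>j\<in>J. 0 \<le> t j) \<and> (\<Sum>j\<in>J. t j) \<le> 1}"

lemma convex_subconvex_combinations: "convex (subconvex_combinations J z)"
proof (rule convexI)
  fix x y and u v :: real
  assume "x \<in> subconvex_combinations J z" "y \<in> subconvex_combinations J z" and uv: "0 \<le> u" "0 \<le> v" "u + v = 1"
  then obtain s t where s: "x = (\<Sum>j\<in>J. s j *\<^sub>R z j)" "\<And>j. j \<in> J \<Longrightarrow> 0 \<le> s j" "(\<Sum>j\<in>J. s j) \<le> 1"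
    and t: "y = (\<Sum>j\<in>J. t j *\<^sub>R z j)" "\<And>j. j \<in> J \<Longrightarrow> 0 \<le> t j" "(\<Sum>j\<in>J. t j) \<le> 1"
    unfolding subconvex_combinations_def by blast
  have "u *\<^sub>R x + v *\<^sub>R y = (\<Sum>j\<in>J. (u * s j + v * t j) *\<^sub>R z j)"
    unfolding s(1) t(1) scaleR_sum_right scaleR_scaleR scaleR_left_distrib sum.distrib ..
  moreover have "(\<Sum>j\<in>J. u * s j + v * t j) \<le> 1"
  proof -
    have "(\<Sum>j\<in>J. u * s j + v * t j) = u * (\<Sum>j\<in>J. s j) + v * (\<Sum>j\<in>J. t j)"
      by (simp add: sum.distrib sum_distrib_left)
    also have "\<dots> \<le> u * 1 + v * 1" using s(3) t(3) uv by (intro add_mono mult_left_mono) auto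
    finally show ?thesis using uv(3) by simp
  qed
  ultimately show "u *\<^sub>R x + v *\<^sub>R y \<in> subconvex_combinations J z"
    unfolding subconvex_combinations_def using s(2) t(2) uv
    by (intro CollectI exI[of _ "\<lambda>j. u * s j + v * t j"]) auto
qed

lemma subconvex_combinations_base:
  assumes "finite J" "j \<in> J"
  shows "z j \<in> subconvex_combinations J z"
  unfolding subconvex_combinations_def
proof (intro CollectI exI[of _ "\<lambda>k. if k = j then 1 else 0"] conjI)
  have "(\<Sum>k\<in>J. (if k = j then 1 else 0 :: real) *\<^sub>R z k) = (\<Sum>k\<in>J. if k = j then z k else 0)"
    by (intro sum.cong) auto
  then show "z j = (\<Sum>k\<in>J. (if k = j then 1 else 0 :: real) *\<^sub>R z k)"
    using assms by (simp only: sum.delta if_True)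
qed (use assms in auto)

text \<open>Caratheodory's theorem covers the hull by the simplices that belong to n-element subsets
  of J; Hadamard's inequality bounds each of them, and the bound on symmetric sums bounds their
  total.\<close>

lemma subconvex_combinations_volume:
  fixes z :: "'i \<Rightarrow> nat \<Rightarrow> real"
  assumes J: "finite J" "n \<le> card J" "\<And>j. j \<in> J \<Longrightarrow> z j \<in> Rn n"
    and A: "A \<subseteq> subconvex_combinations J z"
  shows "emeasure (lborel_Rn n) A \<le> ennreal ((\<Sum>j\<in>J. L2_set (z j) {..<n}) ^ n / (fact n)\<^sup>2)"
proof -
  define \<I> where "\<I> = {I. I \<subseteq> J \<and> card I = n}"
  have fin: "finite \<I>" using J(1) by (simp add: \<I>_def)
  have "\<exists>C\<in>sets borel. subconvex_combinations I z \<subseteq> C \<and>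
      emeasure (lborel_Rn n) C \<le> ennreal ((\<Prod>i\<in>I. L2_set (z i) {..<n}) / fact n)" if "I \<in> \<I>" for I
  proof -
    have I: "I \<subseteq> J" "card I = n" "finite I" using that J(1) by (auto simp: \<I>_def dest: finite_subset)
    then obtain h where h: "bij_betw h {..<n} I"
      using ex_bij_betw_nat_finite[of I] by (auto simp: atLeast0LessThan)
    define y where "y = (\<lambda>i. z (h i))"
    have "y i \<in> Rn n" if "i < n" for i
      using that I J(3) bij_betwE[OF h] unfolding y_def by blast
    then obtain C where C: "C \<in> sets borel" "corner_simplex n y \<subseteq> C"
      "emeasure (lborel_Rn n) C \<le> ennreal ((\<Prod>i<n. L2_set (y i) {..<n}) / fact n)"
      using hadamard_simplex[of n y] by blast
    have "subconvex_combinations I z \<subseteq> corner_simplex n y"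
    proof
      fix x assume "x \<in> subconvex_combinations I z"
      then obtain t where t: "x = (\<Sum>i\<in>I. t i *\<^sub>R z i)" "\<And>i. i \<in> I \<Longrightarrow> 0 \<le> t i" "(\<Sum>i\<in>I. t i) \<le> 1"
        unfolding subconvex_combinations_def by blast
      have "x = (\<Sum>i<n. t (h i) *\<^sub>R y i)"
        unfolding t(1) y_def by (rule sum.reindex_bij_betw[OF h, symmetric])
      moreover have "(\<Sum>i<n. t (h i)) \<le> 1"
        using t(3) sum.reindex_bij_betw[OF h, of t] by simp
      moreover have "\<forall>i<n. 0 \<le> t (h i)" using t(2) bij_betwE[OF h] by blast
      ultimately show "x \<in> corner_simplex n y"
        unfolding corner_simplex_def by (intro CollectI exI[of _ "\<lambda>i. t (h i)"] conjI)
    qed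
    moreover have "(\<Prod>i<n. L2_set (y i) {..<n}) = (\<Prod>i\<in>I. L2_set (z i) {..<n})"
      unfolding y_def by (rule prod.reindex_bij_betw[OF h])
    ultimately show ?thesis using C by auto
  qed
  then obtain C where C: "\<And>I. I \<in> \<I> \<Longrightarrow> C I \<in> sets borel"
    "\<And>I. I \<in> \<I> \<Longrightarrow> subconvex_combinations I z \<subseteq> C I"
    "\<And>I. I \<in> \<I> \<Longrightarrow> emeasure (lborel_Rn n) (C I) \<le> ennreal ((\<Prod>i\<in>I. L2_set (z i) {..<n}) / fact n)"
    by metis
  have "A \<subseteq> (\<Union>I\<in>\<I>. C I)"
  proof
    fix x assume "x \<in> A"
    then have "x \<in> subconvex_combinations J z" using A by blast
    then obtain t where t: "x = (\<Sum>j\<in>J. t j *\<^sub>R z j)" "\<And>j. j \<in> J \<Longrightarrow> 0 \<le> t j" "(\<Sum>j\<in>J. t j) \<le> 1"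
      unfolding subconvex_combinations_def by blast
    obtain I0 u where I0: "I0 \<subseteq> J" "card I0 \<le> n" "\<And>i. i \<in> I0 \<Longrightarrow> 0 \<le> u i"
      "(\<Sum>i\<in>I0. u i) \<le> 1" "x = (\<Sum>i\<in>I0. u i *\<^sub>R z i)"
      using caratheodory_cone[of J z n t] J t by blast
    \<comment> \<open>A set with fewer than n indices is filled up to exactly n; the added points
      get weight 0. This is where J must have at least n elements.\<close>
    obtain I where I: "I0 \<subseteq> I" "I \<subseteq> J" "card I = n"
      using exists_subset_between[OF I0(2) J(2) I0(1) J(1)] by blast
    have fI: "finite I" using I J(1) finite_subset by blast
    define u' where "u' = (\<lambda>i. if i \<in> I0 then u i else 0)"
    have "x = (\<Sum>i\<in>I. u' i *\<^sub>R z i)"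
      unfolding I0(5) using I(1) fI by (intro sum.mono_neutral_cong_left) (auto simp: u'_def)
    moreover have "(\<Sum>i\<in>I. u' i) \<le> 1"
    proof -
      have "(\<Sum>i\<in>I0. u i) = (\<Sum>i\<in>I. u' i)"
        using I(1) fI by (intro sum.mono_neutral_cong_left) (auto simp: u'_def)
      then show ?thesis using I0(4) by simp
    qed
    moreover have "\<forall>i\<in>I. 0 \<le> u' i" using I0(3) by (simp add: u'_def)
    ultimately have "x \<in> subconvex_combinations I z"
      unfolding subconvex_combinations_def by blast
    moreover have "I \<in> \<I>" using I by (simp add: \<I>_def)
    ultimately show "x \<in> (\<Union>I\<in>\<I>. C I)" using C(2) by blast
  qed
  then have "emeasure (lborel_Rn n) A \<le> emeasure (lborel_Rn n) (\<Union>I\<in>\<I>. C I)"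
    using C(1) fin by (intro emeasure_mono) (auto simp: sets_lborel_Rn)
  also have "\<dots> \<le> (\<Sum>I\<in>\<I>. emeasure (lborel_Rn n) (C I))"
    using C(1) fin by (intro emeasure_subadditive_finite) (auto simp: sets_lborel_Rn)
  also have "\<dots> \<le> (\<Sum>I\<in>\<I>. ennreal ((\<Prod>i\<in>I. L2_set (z i) {..<n}) / fact n))"
    using C(3) by (rule sum_mono)
  also have "\<dots> = ennreal (\<Sum>I\<in>\<I>. (\<Prod>i\<in>I. L2_set (z i) {..<n}) / fact n)"
    by (intro sum_ennreal divide_nonneg_nonneg prod_nonneg) auto
  also have "\<dots> \<le> ennreal ((\<Sum>j\<in>J. L2_set (z j) {..<n}) ^ n / (fact n)\<^sup>2)"
  proof (rule ennreal_leI)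
    have "(\<Sum>I\<in>\<I>. (\<Prod>i\<in>I. L2_set (z i) {..<n}) / fact n) = (\<Sum>I\<in>\<I>. \<Prod>i\<in>I. L2_set (z i) {..<n}) / fact n"
      by (simp add: sum_divide_distrib)
    also have "\<dots> \<le> ((\<Sum>j\<in>J. L2_set (z j) {..<n}) ^ n / fact n) / fact n"
      unfolding \<I>_def using J(1) by (intro divide_right_mono sum_prod_subsets_le) auto
    finally show "(\<Sum>I\<in>\<I>. (\<Prod>i\<in>I. L2_set (z i) {..<n}) / fact n) \<le>
        (\<Sum>j\<in>J. L2_set (z j) {..<n}) ^ n / (fact n)\<^sup>2"
      by (simp add: power2_eq_square)
  qed
  finally show ?thesis .
qed

text \<open>The matrix with columns \<open>f i\<close>. It reads finitely many coordinates and is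
  therefore Borel on all sequences, while measurability off \<open>Rn n\<close> is not implied by
  linearity alone.\<close>

definition linear_on_Rn :: "nat \<Rightarrow> (nat \<Rightarrow> nat \<Rightarrow> real) \<Rightarrow> (nat \<Rightarrow> real) \<Rightarrow> nat \<Rightarrow> real"
  where "linear_on_Rn n f x = (\<Sum>i<n. x i *\<^sub>R f i)"

lemma linear_linear_on_Rn: "linear (linear_on_Rn n f)"
  by (rule linearI)
    (simp_all add: linear_on_Rn_def scaleR_left_distrib sum.distrib scaleR_sum_right del: sum_fun_apply)

lemma linear_on_Rn_measurable: "linear_on_Rn n f \<in> borel_measurable borel"
  by (rule measurable_fun_borelI) (simp add: linear_on_Rn_def)

lemma linear_on_Rn_in_Rn:
  assumes "\<And>i. i < n \<Longrightarrow> f i \<in> Rn n"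
  shows "linear_on_Rn n f x \<in> Rn n"
  unfolding linear_on_Rn_def using assms
  by (intro subspace_sum[OF subspace_Rn] subspace_scale[OF subspace_Rn]) auto

lemma linear_on_Rn_eq:
  assumes "linear T" "x \<in> Rn n"
  shows "linear_on_Rn n (\<lambda>i. T (unit_vec i)) x = T x"
proof -
  have "T x = T (\<Sum>i<n. x i *\<^sub>R unit_vec i)" using Rn_expansion[OF assms(2)] by simp
  also have "\<dots> = (\<Sum>i<n. x i *\<^sub>R T (unit_vec i))"
    using assms(1) by (simp only: linear_sum linear_scale)
  finally show ?thesis by (simp only: linear_on_Rn_def)
qed

text \<open>Replaces T and its inverse on \<open>Rn n\<close> by maps that are linear and Borel
  everywhere. The inverse S is built from the preimages of the unit vectors; it is a right inverse
  by linearity and a left inverse by injectivity of T.\<close>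

lemma bij_on_Rn_matrices:
  assumes T: "linear T" and bij: "bij_betw T (Rn n) (Rn n)"
  obtains F S where "linear F" "F \<in> borel_measurable borel" "linear S" "S \<in> borel_measurable borel"
    "\<And>x. x \<in> Rn n \<Longrightarrow> F x = T x" "\<And>x. x \<in> Rn n \<Longrightarrow> S x \<in> Rn n"
    "\<And>x. x \<in> Rn n \<Longrightarrow> T (S x) = x" "\<And>x. x \<in> Rn n \<Longrightarrow> S (T x) = x"
proof -
  define s where "s = (\<lambda>i. inv_into (Rn n) T (unit_vec i))"
  define F where "F = linear_on_Rn n (\<lambda>i. T (unit_vec i))"
  define S where "S = linear_on_Rn n s"
  have TRn: "T ` Rn n = Rn n" using bij by (rule bij_betw_imp_surj_on)
  have u: "unit_vec i \<in> T ` Rn n" if "i < n" for i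
    unfolding TRn using that by (rule unit_vec_in_Rn)
  have s: "s i \<in> Rn n" "T (s i) = unit_vec i" if "i < n" for i
    unfolding s_def by (rule inv_into_into[OF u[OF that]], rule f_inv_into_f[OF u[OF that]])
  have S_Rn: "S x \<in> Rn n" for x unfolding S_def using s(1) by (rule linear_on_Rn_in_Rn)
  have TS: "T (S x) = x" if "x \<in> Rn n" for x
  proof -
    have "T (S x) = (\<Sum>i<n. x i *\<^sub>R T (s i))"
      unfolding S_def linear_on_Rn_def using T by (simp only: linear_sum linear_scale)
    also have "\<dots> = (\<Sum>i<n. x i *\<^sub>R unit_vec i)" using s(2) by (intro sum.cong) simp_all
    also have "\<dots> = x" using Rn_expansion[OF that] by simp
    finally show ?thesis .
  qed
  have ST: "S (T x) = x" if "x \<in> Rn n" for x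
  proof (rule inj_onD[OF bij_betw_imp_inj_on[OF bij]])
    show "T (S (T x)) = T x" using TRn that by (intro TS) blast
  qed (use S_Rn that in auto)
  show ?thesis
    by (rule that[of F S])
      (use S_Rn TS ST linear_on_Rn_eq[OF T] linear_linear_on_Rn linear_on_Rn_measurable F_def S_def in simp_all)
qed

section \<open>Lower bound\<close>

text \<open>The term of index n in the series of \<open>exp n\<close> is at most the whole
  sum.\<close>

lemma fact_ge_power: "(real n / exp 1) ^ n \<le> fact n"
proof -
  have "(\<Sum>k\<in>{n}. real n ^ k /\<^sub>R fact k) \<le> (\<Sum>k. real n ^ k /\<^sub>R fact k)"
    by (rule sum_le_suminf[OF summable_exp_generic]) auto
  then have "real n ^ n / fact n \<le> exp (real n)"
    by (simp add: exp_def divide_inverse mult.commute)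
  then have "real n ^ n \<le> exp (real n) * fact n"
    by (simp add: field_simps)
  moreover have "exp (real n) = exp 1 ^ n"
    using exp_of_nat_mult[of n "1::real"] by simp
  ultimately show ?thesis by (simp add: power_divide field_simps)
qed

lemma unit_ball_iff: "x \<in> unit_ball n \<longleftrightarrow> x \<in> Rn n \<and> L2_set x {..<n} \<le> 1"
  by (simp add: unit_ball_def L2_set_def)

lemma unit_ball_uminus: "- x \<in> unit_ball n \<longleftrightarrow> x \<in> unit_ball n"
  by (simp add: unit_ball_def mem_Rn)

lemma L2_set_fun_scaleR: "L2_set (c *\<^sub>R x) A = \<bar>c\<bar> * L2_set x A" for x :: "nat \<Rightarrow> real"
  by (simp add: L2_set_def power_mult_distrib sum_distrib_left[symmetric] real_sqrt_mult)

text \<open>Both sides would follow from the determinant of T; uniqueness of Haar measure, applied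
  to L and the image of the ball, gives the identity without it. The symmetry of the ball absorbs
  the minus sign.\<close>

lemma ellipsoid_volume_identity:
  assumes F: "linear F" "F \<in> borel_measurable borel" and S: "S \<in> borel_measurable borel"
    and FT: "\<And>x. x \<in> Rn n \<Longrightarrow> F x = T x" and S_Rn: "\<And>x. x \<in> Rn n \<Longrightarrow> S x \<in> Rn n"
    and TS: "\<And>x. x \<in> Rn n \<Longrightarrow> T (S x) = x" and ST: "\<And>x. x \<in> Rn n \<Longrightarrow> S (T x) = x"
    and T_Rn: "\<And>x. x \<in> Rn n \<Longrightarrow> T x \<in> Rn n"
    and c: "c \<in> Rn n" and L: "L \<in> sets borel"
  shows "emeasure (lborel_Rn n) {x. F x \<in> L} * emeasure (lborel_Rn n) ((\<lambda>x. c + T x) ` unit_ball n) =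
    emeasure (lborel_Rn n) (unit_ball n) * emeasure (lborel_Rn n) L"
proof -
  let ?M = "lborel_Rn n"
  have sp: "subspace (Rn n)" by (rule subspace_Rn)
  \<comment> \<open>The image of the ball under T, written as a preimage under its inverse so that
    it is visibly Borel.\<close>
  define E0 where "E0 = Rn n \<inter> (S -` unit_ball n \<inter> space borel)"
  have E0 [measurable]: "E0 \<in> sets borel"
    unfolding E0_def using measurable_sets[OF S unit_ball_sets[of n]] by (intro sets.Int sets_Rn) auto
  have E0_eq: "E0 = T ` unit_ball n"
  proof (intro equalityI subsetI)
    fix x assume "x \<in> E0"
    then have "x = T (S x)" "S x \<in> unit_ball n" using TS by (auto simp: E0_def)
    then show "x \<in> T ` unit_ball n" by blast
  next
    fix x assume "x \<in> T ` unit_ball n"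
    then obtain b where "b \<in> unit_ball n" "x = T b" by blast
    moreover from this have "b \<in> Rn n" by (simp add: unit_ball_iff)
    ultimately show "x \<in> E0" using ST T_Rn by (simp add: E0_def)
  qed
  have trans: "(\<lambda>x. c + T x) ` unit_ball n = {x. - c + 1 *\<^sub>R x \<in> E0}"
  proof (intro equalityI subsetI)
    fix x assume "x \<in> {x. - c + 1 *\<^sub>R x \<in> E0}"
    then obtain b where b: "b \<in> unit_ball n" "- c + x = T b" unfolding E0_eq by auto
    have "x = c + (- c + x)" by simp
    then show "x \<in> (\<lambda>x. c + T x) ` unit_ball n" using b by (metis imageI)
  next
    fix x assume "x \<in> (\<lambda>x. c + T x) ` unit_ball n"
    then obtain b where b: "b \<in> unit_ball n" "x = c + T b" by blast
    then have "- c + 1 *\<^sub>R x = T b" by simp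
    then show "x \<in> {x. - c + 1 *\<^sub>R x \<in> E0}" unfolding E0_eq using b(1) by blast
  qed
  have "emeasure ?M ((\<lambda>x. c + T x) ` unit_ball n) = emeasure ?M E0"
    unfolding trans using emeasure_lborel_Rn_affine_vimage[OF E0 _ subspace_neg[OF sp c], of 1] by simp
  moreover have "emeasure ?M {x. F x \<in> L} * emeasure ?M E0 = emeasure ?M {x. - F x \<in> E0} * emeasure ?M L"
  proof (rule haar_uniqueness[OF F(2) _ _ _ L E0])
    show "F (x + y) = F x + F y" for x y using F(1) by (rule linear_add)
    show "F x \<in> Rn n" if "x \<in> Rn n" for x using FT[OF that] T_Rn[OF that] by simp
    show "\<exists>x\<in>Rn n. F x = y" if "y \<in> Rn n" for y
      using FT[OF S_Rn[OF that]] TS[OF that] S_Rn[OF that] by (intro bexI[of _ "S y"]) simp_all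
  qed
  moreover have "emeasure ?M {x. - F x \<in> E0} = emeasure ?M (unit_ball n)"
  proof (rule emeasure_eq_AE)
    show "{x. - F x \<in> E0} \<in> sets ?M"
      using measurable_sets[OF borel_measurable_fun_uminus[OF F(2)] E0]
      by (simp add: vimage_def sets_lborel_Rn)
    show "unit_ball n \<in> sets ?M" by (simp add: sets_lborel_Rn)
    show "AE x in ?M. (x \<in> {x. - F x \<in> E0}) = (x \<in> unit_ball n)"
      using AE_lborel_Rn[of n]
    proof eventually_elim
      case (elim x)
      then have mx: "- x \<in> Rn n" by (rule subspace_neg[OF sp])
      have "- F x = F (- x)" using linear_neg[OF F(1)] by simp
      also have "\<dots> = T (- x)" using mx by (rule FT)
      finally have "- F x = T (- x)" .
      moreover have "T (- x) \<in> E0 \<longleftrightarrow> - x \<in> unit_ball n"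
        using T_Rn[OF mx] ST[OF mx] by (simp add: E0_def)
      ultimately show ?case by (simp add: unit_ball_uminus)
    qed
  qed
  ultimately show ?thesis by simp
qed

text \<open>If S maps K into the ball, then every t with y in tK is at least the norm of
  \<open>S y\<close>. Absorption guarantees that the infimum is over a nonempty set.\<close>

lemma L2_set_le_minkowski_functional:
  fixes K :: "(nat \<Rightarrow> real) set" and n :: nat
  assumes absorb: "\<exists>t>0. y \<in> (*\<^sub>R) t ` K" and S: "linear S"
    and K: "\<And>x. x \<in> K \<Longrightarrow> L2_set (S x) {..<n} \<le> 1"
  shows "L2_set (S y) {..<n} \<le> minkowski_functional K y"
  unfolding minkowski_functional_def
proof (rule cInf_greatest)
  show "{t. 0 < t \<and> y \<in> (*\<^sub>R) t ` K} \<noteq> {}" using absorb by auto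
next
  fix t assume "t \<in> {t. 0 < t \<and> y \<in> (*\<^sub>R) t ` K}"
  then obtain x where x: "0 < t" "x \<in> K" "y = t *\<^sub>R x" by auto
  have "L2_set (S y) {..<n} = t * L2_set (S x) {..<n}"
    using x(1) by (simp only: x(3) linear_scale[OF S] L2_set_fun_scaleR abs_of_pos)
  also have "\<dots> \<le> t" using K[OF x(2)] x(1) by (simp add: mult_le_cancel_left1)
  finally show "L2_set (S y) {..<n} \<le> t" .
qed

text \<open>Writing x as half the difference of x and -x cancels the center c, so an ellipsoid
  around a symmetric set may be moved to the origin.\<close>

lemma symmetric_ellipsoid_recenter:
  fixes S T :: "(nat \<Rightarrow> real) \<Rightarrow> nat \<Rightarrow> real"
  assumes S: "linear S" and ST: "\<And>x. x \<in> Rn n \<Longrightarrow> S (T x) = x"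
    and x: "x \<in> (\<lambda>x. c + T x) ` unit_ball n" "- x \<in> (\<lambda>x. c + T x) ` unit_ball n"
  shows "L2_set (S x) {..<n} \<le> 1"
proof -
  obtain b b' where b: "b \<in> unit_ball n" "x = c + T b" and b': "b' \<in> unit_ball n" "- x = c + T b'"
    using x by blast
  have "x = (1/2) *\<^sub>R (x - - x)" by (simp add: scaleR_2[symmetric] del: scaleR_fun_apply)
  also have "x - - x = T b - T b'" unfolding b'(2) by (simp add: b(2))
  finally have "S x = (1/2) *\<^sub>R (S (T b) - S (T b'))"
    using S by (simp only: linear_scale linear_diff)
  also have "\<dots> = (1/2) *\<^sub>R b + (1/2) *\<^sub>R (- b')"
    using ST b(1) b'(1) by (simp add: unit_ball_iff fun_eq_iff field_simps)
  finally have Sx: "S x = (\<lambda>i. ((1/2) *\<^sub>R b) i + ((1/2) *\<^sub>R (- b')) i)" by (simp add: plus_fun_def)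
  have "L2_set (S x) {..<n} \<le> L2_set ((1/2) *\<^sub>R b) {..<n} + L2_set ((1/2) *\<^sub>R (- b')) {..<n}"
    unfolding Sx by (rule L2_set_triangle_ineq)
  also have "\<dots> \<le> 1"
    using b(1) b'(1) unit_ball_uminus[of b' n] unfolding L2_set_fun_scaleR unit_ball_iff by simp
  finally show ?thesis .
qed

text \<open>The lower bound for one ellipsoid and one choice of vertices; the infima are taken
  afterwards.\<close>

lemma vertex_sum_ellipsoid_bound:
  fixes y :: "nat \<Rightarrow> nat \<Rightarrow> real"
  assumes n: "n \<ge> 1" and K: "K \<subseteq> Rn n"
    and absorb: "\<And>y. y \<in> Rn n \<Longrightarrow> \<exists>t>0. y \<in> (*\<^sub>R) t ` K"
    and E: "ellipsoid n E" "convex hull (K \<union> uminus ` K) \<subseteq> E"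
    and pos: "vol n (convex hull (K \<union> uminus ` K)) > 0"
    and y: "\<And>j. j < N \<Longrightarrow> y j \<in> Rn n" and hull: "K \<subseteq> convex hull (y ` {..<N})"
  defines "s \<equiv> \<Sum>j<N. minkowski_functional K (y j)"
  shows "s > 0" "exp (- 2) * real n powr (3 / 2) / s \<le>
    (vol n E / vol n (convex hull (K \<union> uminus ` K))) powr (1 / real n)"
proof -
  let ?M = "lborel_Rn n"
  define L where "L = convex hull (K \<union> uminus ` K)"
  have sp: "subspace (Rn n)" by (rule subspace_Rn)
  \<comment> \<open>A set that is not Borel would be assigned measure 0, contrary to the positive
    volume.\<close>
  have L: "L \<in> sets borel"
  proof (rule ccontr)
    assume "L \<notin> sets borel"
    then have "measure ?M L = 0" by (intro measure_notin_sets) (simp add: sets_lborel_Rn)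
    then show False using pos by (simp add: L_def vol_def)
  qed
  obtain T c where T: "linear T" "bij_betw T (Rn n) (Rn n)" and c: "c \<in> Rn n"
    and E_eq: "E = (\<lambda>x. c + T x) ` unit_ball n"
    using E(1) unfolding ellipsoid_def by blast
  have T_Rn: "\<And>x. x \<in> Rn n \<Longrightarrow> T x \<in> Rn n" using bij_betwE[OF T(2)] by blast
  obtain F S where F: "linear F" "F \<in> borel_measurable borel" and S: "linear S" "S \<in> borel_measurable borel"
    and FT: "\<And>x. x \<in> Rn n \<Longrightarrow> F x = T x" and S_Rn: "\<And>x. x \<in> Rn n \<Longrightarrow> S x \<in> Rn n"
    and TS: "\<And>x. x \<in> Rn n \<Longrightarrow> T (S x) = x" and ST: "\<And>x. x \<in> Rn n \<Longrightarrow> S (T x) = x"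
    by (rule bij_on_Rn_matrices[OF T]) blast
  have sym: "x \<in> L" "- x \<in> L" if "x \<in> K" for x
    using that hull_subset[of "K \<union> uminus ` K" convex] unfolding L_def by blast+
  have K_ball: "L2_set (S x) {..<n} \<le> 1" if "x \<in> K" for x
  proof (rule symmetric_ellipsoid_recenter[of S n T x c])
    show "x \<in> (\<lambda>x. c + T x) ` unit_ball n" "- x \<in> (\<lambda>x. c + T x) ` unit_ball n"
      using sym[OF that] E(2) unfolding L_def[symmetric] E_eq by blast+
  qed (use S(1) ST in blast)+
  have z_le: "L2_set (S (y j)) {..<n} \<le> minkowski_functional K (y j)" if "j < N" for j
    by (rule L2_set_le_minkowski_functional[OF absorb[OF y[OF that]] S(1) K_ball])

  \<comment> \<open>The second component is the sign; the indices with sign 0 only pad the family to \<open>n\<close> members.\<close>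
  define J where "J = {..<N} \<times> {- 1, 1 :: real} \<union> {..<n} \<times> {0}"
  define p where "p = (\<lambda>(j, \<epsilon>). \<epsilon> *\<^sub>R y j)"
  define q where "q = (\<lambda>a. S (p a))"
  have finJ: "finite J" by (simp add: J_def)
  have cardJ: "n \<le> card J"
  proof -
    have "card ({..<n} \<times> {0 :: real}) \<le> card J" by (rule card_mono[OF finJ]) (auto simp: J_def)
    then show ?thesis by (simp add: card_cartesian_product)
  qed
  have pJ: "p a \<in> Rn n" if "a \<in> J" for a
  proof -
    obtain j \<epsilon> where a: "a = (j, \<epsilon>)" by (cases a)
    show ?thesis
    proof (cases "\<epsilon> = 0")
      case True
      then show ?thesis using subspace_0[OF sp] by (simp add: a p_def)
    next
      case False
      then have "j < N" using that by (auto simp: a J_def)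
      then show ?thesis using subspace_scale[OF sp y] by (simp add: a p_def del: scaleR_fun_apply)
    qed
  qed
  have qJ: "q a \<in> Rn n" if "a \<in> J" for a unfolding q_def using pJ[OF that] by (rule S_Rn)
  have L_sub: "L \<subseteq> subconvex_combinations J p"
  proof -
    let ?Q = "subconvex_combinations J p"
    have yQ: "\<epsilon> *\<^sub>R y j \<in> ?Q" if "j < N" "\<epsilon> \<in> {- 1, 1}" for j \<epsilon>
    proof -
      have "(j, \<epsilon>) \<in> J" using that by (auto simp: J_def)
      from subconvex_combinations_base[OF finJ this, of p] show ?thesis by (simp only: p_def prod.case)
    qed
    have y1: "y ` {..<N} \<subseteq> ?Q" using yQ[of _ 1] by auto
    have y2: "(\<lambda>x. - 1 *\<^sub>R x) ` y ` {..<N} \<subseteq> ?Q" using yQ[of _ "- 1"] by auto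
    have "convex hull (y ` {..<N}) \<subseteq> ?Q"
      using y1 convex_subconvex_combinations by (rule hull_minimal)
    \<comment> \<open>The reflected hull is the hull of the reflected vertices, so the signs in J
      cover -K as well.\<close>
    moreover have "(\<lambda>x. - 1 *\<^sub>R x) ` (convex hull (y ` {..<N})) \<subseteq> ?Q"
      unfolding convex_hull_scaling[symmetric] using y2 convex_subconvex_combinations by (rule hull_minimal)
    ultimately have "K \<union> uminus ` K \<subseteq> ?Q" using hull by auto
    then show ?thesis unfolding L_def using convex_subconvex_combinations by (rule hull_minimal)
  qed
  define A where "A = Rn n \<inter> {x. F x \<in> L}"
  have FL: "{x. F x \<in> L} \<in> sets ?M"
    using measurable_sets[OF F(2) L] by (simp add: vimage_def sets_lborel_Rn)
  have "A \<subseteq> subconvex_combinations J q"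
  proof
    fix x assume "x \<in> A"
    then have x: "x \<in> Rn n" "F x \<in> subconvex_combinations J p" using L_sub by (auto simp: A_def)
    then obtain t where t: "F x = (\<Sum>a\<in>J. t a *\<^sub>R p a)" "\<forall>a\<in>J. 0 \<le> t a" "(\<Sum>a\<in>J. t a) \<le> 1"
      unfolding subconvex_combinations_def by blast
    have "x = S (F x)" using ST[OF x(1)] FT[OF x(1)] by simp
    also have "\<dots> = (\<Sum>a\<in>J. t a *\<^sub>R q a)"
      unfolding t(1) q_def using S(1) by (simp only: linear_sum linear_scale)
    finally show "x \<in> subconvex_combinations J q"
      unfolding subconvex_combinations_def using t(2,3) by blast
  qed
  then have emA: "emeasure ?M A \<le> ennreal ((\<Sum>a\<in>J. L2_set (q a) {..<n}) ^ n / (fact n)\<^sup>2)"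
    using qJ by (intro subconvex_combinations_volume[OF finJ cardJ]) auto
  \<comment> \<open>Each vertex occurs with both signs, which doubles the sum; the padding points
    are zero.\<close>
  have sum_q: "(\<Sum>a\<in>J. L2_set (q a) {..<n}) \<le> 2 * s"
  proof -
    have q: "L2_set (q (j, \<epsilon>)) {..<n} = \<bar>\<epsilon>\<bar> * L2_set (S (y j)) {..<n}" for j \<epsilon>
      unfolding q_def p_def using S(1) by (simp only: prod.case linear_scale L2_set_fun_scaleR)
    have "(\<Sum>a\<in>J. L2_set (q a) {..<n}) =
        (\<Sum>a\<in>{..<N} \<times> {- 1, 1}. L2_set (q a) {..<n}) + (\<Sum>a\<in>{..<n} \<times> {0}. L2_set (q a) {..<n})"
      unfolding J_def by (rule sum.union_disjoint) auto
    also have "(\<Sum>a\<in>{..<n} \<times> {0}. L2_set (q a) {..<n}) = 0"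
      by (rule sum.neutral) (auto simp: q)
    also have "(\<Sum>a\<in>{..<N} \<times> {- 1, 1}. L2_set (q a) {..<n}) =
        (\<Sum>j<N. \<Sum>\<epsilon>\<in>{- 1, 1}. L2_set (q (j, \<epsilon>)) {..<n})"
      unfolding sum.cartesian_product by (intro sum.cong) auto
    also have "\<dots> = 2 * (\<Sum>j<N. L2_set (S (y j)) {..<n})"
      by (simp add: q sum_distrib_left)
    also have "\<dots> + 0 \<le> 2 * s" unfolding s_def using z_le by (auto intro: sum_mono)
    finally show ?thesis .
  qed
  define V where "V = (\<Sum>a\<in>J. L2_set (q a) {..<n}) ^ n / (fact n)\<^sup>2"
  have sum_q0: "0 \<le> (\<Sum>a\<in>J. L2_set (q a) {..<n})" by (intro sum_nonneg) auto
  have V: "0 \<le> V" "V \<le> (2 * s) ^ n / (fact n)\<^sup>2"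
    unfolding V_def using sum_q0 divide_right_mono[OF power_mono[OF sum_q sum_q0, of n], of "(fact n)\<^sup>2"]
    by simp_all
  have mA: "measure ?M {x. F x \<in> L} \<le> V"
  proof -
    have "emeasure ?M {x. F x \<in> L} = emeasure ?M A"
    proof (rule emeasure_eq_AE)
      show "AE x in ?M. (x \<in> {x. F x \<in> L}) = (x \<in> A)"
        using AE_lborel_Rn[of n] by eventually_elim (simp add: A_def)
      show "A \<in> sets ?M" unfolding A_def using FL sets_Rn[of n] by (auto simp: sets_lborel_Rn)
    qed (rule FL)
    then have "emeasure ?M {x. F x \<in> L} \<le> ennreal V" using emA by (simp add: V_def)
    then show ?thesis unfolding measure_def using V(1) by (metis enn2real_leI)
  qed
  have id: "measure ?M {x. F x \<in> L} * vol n E = vol n (unit_ball n) * vol n L"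
    using ellipsoid_volume_identity[OF F S(2) FT S_Rn TS ST T_Rn c L]
    unfolding vol_def measure_def E_eq enn2real_mult[symmetric] by simp
  have B: "(2 / sqrt (real n)) ^ n \<le> vol n (unit_ball n)"
  proof -
    have "enn2real (ennreal ((2 / sqrt (real n)) ^ n)) \<le> enn2real (emeasure ?M (unit_ball n))"
      using unit_ball_lower[OF n] unit_ball_finite[of n] by (intro enn2real_mono) auto
    then show ?thesis by (simp add: vol_def measure_def)
  qed
  have posL: "vol n L > 0" using pos by (simp add: L_def)
  have volE: "0 \<le> vol n E" by (simp add: vol_def)
  have B0: "0 < (2 / sqrt (real n)) ^ n" using n by simp
  have main: "(2 / sqrt (real n)) ^ n * vol n L \<le> (2 * s) ^ n / (fact n)\<^sup>2 * vol n E"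
  proof -
    have "(2 / sqrt (real n)) ^ n * vol n L \<le> measure ?M {x. F x \<in> L} * vol n E"
      unfolding id using B posL by (intro mult_right_mono) auto
    also have "\<dots> \<le> (2 * s) ^ n / (fact n)\<^sup>2 * vol n E"
      using mA V(2) volE by (intro mult_right_mono) auto
    finally show ?thesis .
  qed
  have s0: "0 \<le> s" using sum_q sum_q0 by simp
  show "s > 0"
  proof (rule ccontr)
    assume "\<not> s > 0"
    then have "s = 0" using s0 by simp
    then have "(2 / sqrt (real n)) ^ n * vol n L \<le> 0" using main n by (simp add: power_0_left)
    then show False using B0 posL by (simp add: mult_le_0_iff)
  qed
  define r where "r = exp (- 2) * real n powr (3 / 2) / s"
  have r0: "r > 0" using \<open>s > 0\<close> n by (simp add: r_def)
  have "r ^ n \<le> vol n E / vol n L"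
  proof -
    have n0: "real n > 0" using n by simp
    have "(real n / exp 1) ^ n * (real n / exp 1) ^ n \<le> fact n * fact n"
      by (intro mult_mono fact_ge_power) auto
    then have f: "((real n / exp 1)\<^sup>2) ^ n \<le> (fact n)\<^sup>2"
      by (simp only: power2_eq_square power_mult_distrib)
    have "exp (- 2 :: real) = 1 / (exp 1)\<^sup>2"
      using exp_of_nat_mult[of 2 "1 :: real"] by (simp add: exp_minus inverse_eq_divide)
    moreover have "real n powr (3 / 2) = (real n)\<^sup>2 / sqrt (real n)"
    proof -
      have "real n powr (3 / 2) = real n powr (2 - 1 / 2)" by simp
      also have "\<dots> = (real n)\<^sup>2 / sqrt (real n)"
        using n0 by (simp only: powr_diff powr_half_sqrt) (simp add: powr_half_sqrt)
      finally show ?thesis .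
    qed
    \<comment> \<open>Rewritten so that its n-th power meets the bound for the ball and the
      factorial estimate factor by factor.\<close>
    ultimately have req: "r = (2 / sqrt (real n)) * (real n / exp 1)\<^sup>2 / (2 * s)"
      unfolding r_def by (simp add: power_divide)
    have "r ^ n = (2 / sqrt (real n)) ^ n * ((real n / exp 1)\<^sup>2) ^ n / (2 * s) ^ n"
      unfolding req power_divide power_mult_distrib by simp
    also have "\<dots> \<le> (2 / sqrt (real n)) ^ n * (fact n)\<^sup>2 / (2 * s) ^ n"
      using f \<open>s > 0\<close> by (intro divide_right_mono mult_left_mono) auto
    also have "\<dots> \<le> vol n E / vol n L"
    proof -
      have "P * f / Q \<le> a / b" if "P * b \<le> Q / f * a" "0 < b" "0 < Q" "0 < f" for P Q f a b :: real
        using that by (simp add: field_simps)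
      from this[OF main posL] show ?thesis using \<open>s > 0\<close> by simp
    qed
    finally show ?thesis .
  qed
  then have "(r ^ n) powr (1 / real n) \<le> (vol n E / vol n L) powr (1 / real n)"
    using r0 by (intro powr_mono2) auto
  moreover have "(r ^ n) powr (1 / real n) = r"
    using r0 n by (simp add: powr_realpow[symmetric] powr_powr)
  ultimately show "exp (- 2) * real n powr (3 / 2) / s \<le>
      (vol n E / vol n (convex hull (K \<union> uminus ` K))) powr (1 / real n)"
    by (simp add: r_def L_def)
qed

section \<open>Centered convex bodies and the upper bound\<close>

lemma convex_body_subset_Rn: "convex_body n K \<Longrightarrow> K \<subseteq> Rn n"
  unfolding convex_body_def by (auto dest: compactin_subset_topspace)

lemma convex_body_compact:
  assumes "convex_body n K"
  shows "compact K"
proof -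
  have "compactin (subtopology (powertop_real UNIV) {x. \<forall>i\<ge>n. x i = 0}) K"
    using assms unfolding convex_body_def Euclidean_space_def by blast
  then have "compactin (powertop_real UNIV) K" by (simp only: compactin_subtopology)
  then show ?thesis unfolding euclidean_product_topology compactin_euclidean_iff .
qed

text \<open>A basic open set of the product topology restricts coordinates separately; within
  \<open>Rn n\<close> only the first n of them vary, so a common radius exists.\<close>

lemma convex_body_contains_box:
  assumes "convex_body n K"
  obtains x0 r where "x0 \<in> K" "r > 0" "\<forall>x\<in>Rn n. (\<forall>i<n. \<bar>x i - x0 i\<bar> < r) \<longrightarrow> x \<in> K"
proof -
  obtain x0 where "x0 \<in> Euclidean_space n interior_of K"
    using assms by (auto simp: convex_body_def)
  then obtain U where U: "openin (Euclidean_space n) U" "x0 \<in> U" "U \<subseteq> K"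
    by (auto simp: interior_of_def)
  then obtain W where W: "openin (powertop_real UNIV) W" "U = W \<inter> {x. \<forall>i\<ge>n. x i = 0}"
    unfolding Euclidean_space_def openin_subtopology by blast
  have x0W: "x0 \<in> W" using U(2) unfolding W(2) by blast
  obtain X where X: "x0 \<in> (\<Pi>\<^sub>E i\<in>UNIV. X i)" "\<And>i. open (X i)" "(\<Pi>\<^sub>E i\<in>UNIV. X i) \<subseteq> W"
    using product_topology_open_contains_basis[OF W(1) x0W] unfolding open_openin[symmetric] by blast
  have "\<exists>e>0. \<forall>h. \<bar>h - x0 i\<bar> < e \<longrightarrow> h \<in> X i" for i
  proof -
    have "x0 i \<in> X i" using X(1) by auto
    then obtain e where "e > 0" "ball (x0 i) e \<subseteq> X i" using X(2) by (meson openE)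
    then show ?thesis by (intro exI[of _ e]) (auto simp: ball_def dist_real_def abs_minus_commute subset_iff)
  qed
  then obtain e where e: "\<And>i. e i > 0" "\<And>i h. \<bar>h - x0 i\<bar> < e i \<Longrightarrow> h \<in> X i" by metis
  \<comment> \<open>The element 1 keeps the set nonempty when n = 0.\<close>
  define r where "r = Min (insert 1 (e ` {..<n}))"
  have x0: "\<And>i. i \<ge> n \<Longrightarrow> x0 i = 0" using U(2) unfolding W(2) by blast
  show ?thesis
  proof (rule that[of x0 r])
    show "x0 \<in> K" using U by blast
    show "r > 0" using e(1) by (auto simp: r_def)
    show "\<forall>x\<in>Rn n. (\<forall>i<n. \<bar>x i - x0 i\<bar> < r) \<longrightarrow> x \<in> K"
    proof (intro ballI impI)
      fix x assume x: "x \<in> Rn n" and close: "\<forall>i<n. \<bar>x i - x0 i\<bar> < r"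
      have "x i \<in> X i" for i
      proof (rule e(2))
        show "\<bar>x i - x0 i\<bar> < e i"
        proof (cases "i < n")
          case True
          then have "r \<le> e i" unfolding r_def by (intro Min_le) auto
          then show ?thesis using close True by force
        next
          case False
          then show ?thesis using x x0 e(1) by (simp add: mem_Rn)
        qed
      qed
      then have "x \<in> W" using X(3) by auto
      then have "x \<in> U" unfolding W(2) using x by (simp add: mem_Rn)
      then show "x \<in> K" using U(3) by blast
    qed
  qed
qed

lemma convex_body_bounded:
  assumes "convex_body n K"
  obtains R where "R > 0" "\<forall>x\<in>K. \<forall>i. \<bar>x i\<bar> \<le> R"
proof -
  have "continuous_on K (\<lambda>x. \<Sum>i<n. \<bar>x i\<bar>)"
    by (intro continuous_intros continuous_on_subset[OF continuous_on_product_coordinates]) auto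
  then have "bounded ((\<lambda>x. \<Sum>i<n. \<bar>x i\<bar>) ` K)"
    using convex_body_compact[OF assms] by (intro compact_imp_bounded compact_continuous_image)
  then obtain R where R: "R > 0" "\<And>x. x \<in> K \<Longrightarrow> \<bar>\<Sum>i<n. \<bar>x i\<bar>\<bar> \<le> R"
    unfolding bounded_pos by auto
  show ?thesis
  proof (rule that[OF R(1)], intro ballI allI)
    fix x i assume x: "x \<in> K"
    show "\<bar>x i\<bar> \<le> R"
    proof (cases "i < n")
      case True
      then have "\<bar>x i\<bar> \<le> (\<Sum>i<n. \<bar>x i\<bar>)" by (intro member_le_sum) auto
      then show ?thesis using R(2)[OF x] by linarith
    next
      case False
      then have "x i = 0" using convex_body_subset_Rn[OF assms] x by (auto simp: mem_Rn)
      then show ?thesis using R(1) by simp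
    qed
  qed
qed

lemma convex_body_sets: "convex_body n K \<Longrightarrow> K \<in> sets borel"
  by (intro borel_compact convex_body_compact)

lemma convex_body_emeasure:
  assumes "convex_body n K"
  shows "emeasure (lborel_Rn n) K < \<infinity>" "vol n K > 0"
proof -
  obtain R where R: "R > 0" "\<forall>x\<in>K. \<forall>i. \<bar>x i\<bar> \<le> R" using convex_body_bounded[OF assms] .
  have "K \<subseteq> {x. \<forall>i<n. x i \<in> {- R..R}}"
  proof (intro subsetI CollectI allI impI)
    show "x i \<in> {- R..R}" if "x \<in> K" for x i using R(2)[rule_format, OF that, of i] by auto
  qed
  then have "emeasure (lborel_Rn n) K \<le> emeasure (lborel_Rn n) {x. \<forall>i<n. x i \<in> {- R..R}}"
    by (rule emeasure_mono) (simp add: sets_lborel_Rn sets_cube del: atLeastAtMost_iff)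
  also have "\<dots> < \<infinity>" using R(1) by (subst emeasure_cube) simp_all
  finally show fin: "emeasure (lborel_Rn n) K < \<infinity>" .
  obtain x0 r where "x0 \<in> K" and r: "r > 0"
    and box: "\<forall>x\<in>Rn n. (\<forall>i<n. \<bar>x i - x0 i\<bar> < r) \<longrightarrow> x \<in> K"
    using convex_body_contains_box[OF assms] .
  let ?B = "{x. \<forall>i<n. x i \<in> {x0 i - r<..<x0 i + r}}"
  have "AE x in lborel_Rn n. x \<in> ?B \<longrightarrow> x \<in> K"
    using AE_lborel_Rn[of n]
  proof eventually_elim
    case (elim x)
    show ?case
    proof
      assume "x \<in> ?B"
      then have "\<forall>i<n. \<bar>x i - x0 i\<bar> < r" by (auto simp: abs_less_iff)
      then show "x \<in> K" using box elim by blast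
    qed
  qed
  then have le: "emeasure (lborel_Rn n) ?B \<le> emeasure (lborel_Rn n) K"
    by (rule emeasure_mono_AE) (simp add: sets_lborel_Rn convex_body_sets[OF assms])
  have e1: "emeasure (lborel_Rn n) ?B = (\<Prod>i<n. emeasure lborel {x0 i - r<..<x0 i + r})"
    by (rule emeasure_lborel_Rn_box) simp
  have e2: "(\<Prod>i<n. emeasure lborel {x0 i - r<..<x0 i + r}) = ennreal (2 * r) ^ n"
    using r by simp
  have e3: "ennreal (2 * r) ^ n = ennreal ((2 * r) ^ n)" using r by (intro ennreal_power) simp
  have "ennreal ((2 * r) ^ n) \<le> emeasure (lborel_Rn n) K" using le unfolding e1 e2 e3 .
  then have "0 < emeasure (lborel_Rn n) K" by (rule less_le_trans[rotated]) (use r in simp)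
  then show "vol n K > 0" using fin by (simp add: vol_def measure_def enn2real_positive_iff)
qed

text \<open>The normal points from the nearest point y0 of K to b. Moving from y0 towards another
  point of K cannot decrease the distance to b, which to first order is the required
  inequality.\<close>

lemma separating_functional:
  assumes K: "compact K" "convex K" "K \<subseteq> Rn n" "K \<noteq> {}" and b: "b \<in> Rn n" "b \<notin> K"
  obtains a h where "\<And>y. y \<in> K \<Longrightarrow> (\<Sum>i<n. a i * y i) \<le> h" "h < (\<Sum>i<n. a i * b i)"
proof -
  define d where "d = (\<lambda>y :: nat \<Rightarrow> real. \<Sum>i<n. (y i - b i)\<^sup>2)"
  have "continuous_on K d"
    unfolding d_def
    by (intro continuous_intros continuous_on_subset[OF continuous_on_product_coordinates]) auto
  then obtain y0 where y0: "y0 \<in> K" "\<And>y. y \<in> K \<Longrightarrow> d y0 \<le> d y"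
    using continuous_attains_inf[OF K(1,4)] by blast
  define a where "a = (\<lambda>i. b i - y0 i)"
  show ?thesis
  proof (rule that[of a "\<Sum>i<n. a i * y0 i"])
    have "\<exists>i<n. a i \<noteq> 0"
    proof (rule ccontr)
      assume "\<not> ?thesis"
      then have "b i = y0 i" for i
        using b(1) K(3) y0(1) by (cases "i < n") (auto simp: a_def mem_Rn)
      then have "b = y0" ..
      then show False using b(2) y0(1) by simp
    qed
    then obtain k where "k < n" "a k \<noteq> 0" by blast
    then have "0 < (\<Sum>i<n. (a i)\<^sup>2)"
      by (intro sum_pos2[of _ k]) auto
    also have "\<dots> = (\<Sum>i<n. a i * b i) - (\<Sum>i<n. a i * y0 i)"
      unfolding sum_subtractf[symmetric] by (intro sum.cong) (auto simp: a_def power2_eq_square algebra_simps)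
    finally show "(\<Sum>i<n. a i * y0 i) < (\<Sum>i<n. a i * b i)" by simp
  next
    fix y assume y: "y \<in> K"
    define p where "p = (\<Sum>i<n. a i * (y i - y0 i))"
    define D where "D = (\<Sum>i<n. (y i - y0 i)\<^sup>2)"
    have D: "D \<ge> 0" by (simp add: D_def sum_nonneg)
    have step: "2 * p \<le> t * D" if t: "0 < t" "t \<le> 1" for t
    proof -
      have "(1 - t) *\<^sub>R y0 + t *\<^sub>R y \<in> K" using K(2) y y0(1) t by (intro convexD_alt) auto
      then have "d y0 \<le> d ((1 - t) *\<^sub>R y0 + t *\<^sub>R y)" by (rule y0(2))
      also have "\<dots> = (\<Sum>i<n. (y0 i - b i)\<^sup>2 + (- 2 * t) * (a i * (y i - y0 i)) + t\<^sup>2 * (y i - y0 i)\<^sup>2)"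
        unfolding d_def by (intro sum.cong) (auto simp: a_def power2_eq_square algebra_simps)
      also have "\<dots> = d y0 + (- 2 * t) * p + t\<^sup>2 * D"
        unfolding sum.distrib sum_distrib_left[symmetric] p_def D_def d_def ..
      finally have "t * (2 * p) \<le> t * (t * D)" by (simp add: power2_eq_square algebra_simps)
      then show ?thesis using t(1) by simp
    qed
    have "p \<le> 0"
    proof (rule ccontr)
      assume "\<not> p \<le> 0"
      then have p: "p > 0" by simp
      \<comment> \<open>This makes \<open>t * D\<close> at most p, against the bound
        \<open>2 * p\<close>.\<close>
      define t where "t = min 1 (p / (D + 1))"
      have "0 < t" "t \<le> 1" using p D by (auto simp: t_def)
      then have "2 * p \<le> t * D" by (rule step)
      also have "\<dots> \<le> p / (D + 1) * D" using D by (intro mult_right_mono) (auto simp: t_def)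
      also have "\<dots> \<le> p" using p D by (simp add: field_simps)
      finally show False using p by simp
    qed
    then show "(\<Sum>i<n. a i * y i) \<le> (\<Sum>i<n. a i * y0 i)"
      by (simp add: p_def right_diff_distrib sum_subtractf)
  qed
qed

text \<open>The homothetic copy \<open>(1 - l) x + l K\<close> lies in \<open>K\<close>, so the nonnegative function
  \<open>h - u\<close> has a smaller integral over it than over \<open>K\<close>; letting \<open>l\<close> tend to 1
  yields \<open>- u x \<le> n h\<close> for every functional \<open>u\<close> bounded by \<open>h\<close> on \<open>K\<close>.\<close>

lemma centered_body_functional_bound:
  assumes K: "centered_convex_body n K" and n: "n \<ge> 1" and x: "x \<in> K"
    and h: "\<And>y. y \<in> K \<Longrightarrow> (\<Sum>i<n. a i * y i) \<le> h"
  shows "- (\<Sum>i<n. a i * x i) \<le> real n * h"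
proof -
  let ?M = "lborel_Rn n"
  define u where "u = (\<lambda>y :: nat \<Rightarrow> real. \<Sum>i<n. a i * y i)"
  have body: "convex_body n K" and com: "center_of_mass n K = 0"
    using K by (auto simp: centered_convex_body_def)
  have Ks [measurable]: "K \<in> sets borel" using body by (rule convex_body_sets)
  have um [measurable]: "u \<in> borel_measurable borel" unfolding u_def by measurable
  have cvx: "convex K" using body by (simp add: convex_body_def)
  have fin: "emeasure ?M K < \<infinity>" and pos: "vol n K > 0" using convex_body_emeasure[OF body] by auto
  obtain R where "R > 0" and R: "\<forall>x\<in>K. \<forall>i. \<bar>x i\<bar> \<le> R" using convex_body_bounded[OF body] .
  have int: "integrable ?M (\<lambda>y. indicator K y *\<^sub>R y i)" for i
    using fin R by (intro integrableI_bounded_set_indicator[where B = R]) (auto simp: sets_lborel_Rn)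
  have int1: "integrable ?M (\<lambda>y. indicator K y :: real)"
    using fin by (simp add: sets_lborel_Rn)
  have mean: "(\<integral>y. indicator K y *\<^sub>R y i \<partial>?M) = 0" for i
  proof -
    have "center_of_mass n K i = 0" using com by simp
    then show ?thesis using pos by (simp add: center_of_mass_def set_lebesgue_integral_def)
  qed
  \<comment> \<open>Since the center of mass is 0, the linear part integrates to 0.\<close>
  have affine: "integrable ?M (\<lambda>y. indicator K y * (\<alpha> - \<beta> * u y))"
    "(\<integral>y. indicator K y * (\<alpha> - \<beta> * u y) \<partial>?M) = \<alpha> * vol n K" for \<alpha> \<beta>
  proof -
    have eq: "(\<lambda>y. indicator K y * (\<alpha> - \<beta> * u y)) =
        (\<lambda>y. \<alpha> * indicator K y - (\<Sum>i<n. (\<beta> * a i) * (indicator K y *\<^sub>R y i)))"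
      by (auto simp: fun_eq_iff u_def algebra_simps sum_distrib_left)
    show "integrable ?M (\<lambda>y. indicator K y * (\<alpha> - \<beta> * u y))"
      unfolding eq using int int1
      by (intro Bochner_Integration.integrable_diff Bochner_Integration.integrable_sum integrable_mult_right) auto
    have "(\<integral>y. indicator K y * (\<alpha> - \<beta> * u y) \<partial>?M) =
        (\<integral>y. \<alpha> * indicator K y \<partial>?M) - (\<integral>y. (\<Sum>i<n. (\<beta> * a i) * (indicator K y *\<^sub>R y i)) \<partial>?M)"
      unfolding eq using int int1
      by (intro Bochner_Integration.integral_diff Bochner_Integration.integrable_sum integrable_mult_right) auto
    also have "(\<integral>y. (\<Sum>i<n. (\<beta> * a i) * (indicator K y *\<^sub>R y i)) \<partial>?M) =
        (\<Sum>i<n. \<integral>y. (\<beta> * a i) * (indicator K y *\<^sub>R y i) \<partial>?M)"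
      by (rule Bochner_Integration.integral_sum, rule integrable_mult_right, rule int)
    also have "\<dots> = (\<Sum>i<n. (\<beta> * a i) * (\<integral>y. indicator K y *\<^sub>R y i \<partial>?M))"
      by (simp only: integral_mult_right_zero)
    also have "(\<integral>y. \<alpha> * indicator K y \<partial>?M) = \<alpha> * (\<integral>y. indicator K y \<partial>?M)"
      by (simp only: integral_mult_right_zero)
    also have "\<dots> - (\<Sum>i<n. (\<beta> * a i) * (\<integral>y. indicator K y *\<^sub>R y i \<partial>?M)) = \<alpha> * vol n K"
      unfolding mean by (simp add: vol_def)
    finally show "(\<integral>y. indicator K y * (\<alpha> - \<beta> * u y) \<partial>?M) = \<alpha> * vol n K" .
  qed
  have h': "u y \<le> h" if "y \<in> K" for y using h[OF that] by (simp add: u_def)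
  define g where "g = (\<lambda>y. ennreal (indicator K y * (h - u y)))"
  have g [measurable]: "g \<in> borel_measurable borel" unfolding g_def by measurable
  have int_g: "(\<integral>\<^sup>+y. g y \<partial>?M) = ennreal (h * vol n K)"
    unfolding g_def using affine[of h 1] h'
    by (subst nn_integral_eq_integral) (auto simp: indicator_def)
  have "0 \<le> (\<integral>y. indicator K y * (h - 1 * u y) \<partial>?M)"
    using h' by (intro integral_nonneg_AE AE_I2) (auto simp: indicator_def)
  then have h0: "0 \<le> h" using affine(2)[of h 1] pos by (simp add: zero_le_mult_iff)
  \<comment> \<open>The left side is, up to the factor \<open>vol n K\<close>, the integral of
    \<open>h - u\<close> over the homothetic copy; \<open>l ^ n\<close> is the Jacobian.\<close>
  have key: "l ^ n * (h - (1 - l) * u x) \<le> h" if l: "0 < l" "l < 1" for l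
  proof -
    let ?k = "\<lambda>y. indicator K y * (h - (1 - l) * u x - l * u y)"
    have u_comb: "u ((1 - l) *\<^sub>R x + l *\<^sub>R y) = (1 - l) * u x + l * u y" for y
      by (simp add: u_def algebra_simps sum.distrib sum_distrib_left sum_subtractf)
    have in_K: "(1 - l) *\<^sub>R x + l *\<^sub>R y \<in> K" if "y \<in> K" for y
      using convexD_alt[OF cvx x that, of l] l by simp
    have k0: "0 \<le> ?k y" for y
      using h'[OF in_K, of y] u_comb[of y] by (auto simp: indicator_def)
    have "ennreal (l ^ n) * ennreal ((h - (1 - l) * u x) * vol n K) = ennreal (l ^ n) * (\<integral>\<^sup>+y. ennreal (?k y) \<partial>?M)"
      using affine[of "h - (1 - l) * u x" l] k0 by (subst nn_integral_eq_integral) auto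
    also have "\<dots> \<le> ennreal (l ^ n) * (\<integral>\<^sup>+y. g ((1 - l) *\<^sub>R x + l *\<^sub>R y) \<partial>?M)"
    proof (intro mult_left_mono nn_integral_mono)
      fix y
      show "ennreal (?k y) \<le> g ((1 - l) *\<^sub>R x + l *\<^sub>R y)"
        using in_K[of y] u_comb[of y] by (auto simp: g_def indicator_def diff_diff_eq)
    qed simp
    also have "\<dots> = (\<integral>\<^sup>+y. g y \<partial>?M)"
    proof -
      have "(1 - l) *\<^sub>R x \<in> Rn n"
        using subspace_scale[OF subspace_Rn] convex_body_subset_Rn[OF body] x by blast
      from nn_integral_lborel_Rn_affine[OF g _ this, of l] show ?thesis using l by simp
    qed
    finally have "ennreal (l ^ n) * ennreal ((h - (1 - l) * u x) * vol n K) \<le> ennreal (h * vol n K)"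
      unfolding int_g .
    then have "ennreal (l ^ n * ((h - (1 - l) * u x) * vol n K)) \<le> ennreal (h * vol n K)"
      using l by (simp add: ennreal_mult')
    then have "l ^ n * ((h - (1 - l) * u x) * vol n K) \<le> h * vol n K"
      using h0 pos by (subst (asm) ennreal_le_iff) auto
    then have "(l ^ n * (h - (1 - l) * u x)) * vol n K \<le> h * vol n K" by (simp add: mult.assoc)
    then show ?thesis using pos by (simp add: mult_le_cancel_right)
  qed
  define q where "q = - u x"
  have "q \<le> real n * h"
  proof (rule ccontr)
    assume "\<not> q \<le> real n * h"
    then have q: "real n * h < q" by simp
    have nh: "0 \<le> real n * h" using h0 by simp
    have q0: "0 < q" using q nh by linarith
    \<comment> \<open>Chosen so that \<open>n * \<delta> * q\<close> is half of the supposed excess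
      \<open>q - n * h\<close>; Bernoulli's inequality then leaves a contradiction.\<close>
    define \<delta> where "\<delta> = (q - real n * h) / (2 * real n * q)"
    have nq: "0 < 2 * real n * q" using n q0 by simp
    have \<delta>0: "0 < \<delta>" unfolding \<delta>_def using q nq by simp
    have "q - real n * h \<le> q" using nh by simp
    also have "q < 2 * real n * q" using n q0 by simp
    finally have \<delta>1: "\<delta> < 1" unfolding \<delta>_def using nq by simp
    define l where "l = 1 - \<delta>"
    have l: "0 < l" "l < 1" using \<delta>0 \<delta>1 by (auto simp: l_def)
    have bern: "1 - real n * \<delta> \<le> l ^ n"
      using Bernoulli_inequality[of "- \<delta>" n] \<delta>1 by (simp add: l_def)
    have "l ^ n * (\<delta> * q) \<le> h * (1 - l ^ n)"
      using key[OF l] by (simp add: l_def q_def algebra_simps)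
    also have "\<dots> \<le> h * (real n * \<delta>)" using bern h0 by (intro mult_left_mono) auto
    finally have "\<delta> * (l ^ n * q) \<le> \<delta> * (real n * h)" by (simp add: mult_ac)
    then have le: "l ^ n * q \<le> real n * h" using \<delta>0 by simp
    have "(1 - real n * \<delta>) * q \<le> l ^ n * q" using bern q0 by (intro mult_right_mono) auto
    then have "q - real n * \<delta> * q \<le> real n * h" using le by (simp add: algebra_simps)
    moreover have "real n * \<delta> * q = (q - real n * h) / 2"
      using n q0 by (simp add: \<delta>_def field_simps)
    ultimately have "q - (q - real n * h) / 2 \<le> real n * h" by simp
    then show False using q by (simp add: field_simps)
  qed
  then show ?thesis by (simp add: q_def u_def)
qed

text \<open>Otherwise a functional separates the point from K and violates the preceding
  bound.\<close>

lemma centered_body_reflection: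
  assumes K: "centered_convex_body n K" and n: "n \<ge> 1" and x: "x \<in> K"
  shows "(- 1 / real n) *\<^sub>R x \<in> K"
proof (rule ccontr)
  assume not: "(- 1 / real n) *\<^sub>R x \<notin> K"
  have body: "convex_body n K" using K by (simp add: centered_convex_body_def)
  have "(- 1 / real n) *\<^sub>R x \<in> Rn n"
    using subspace_scale[OF subspace_Rn] convex_body_subset_Rn[OF body] x by blast
  moreover have "K \<noteq> {}" "convex K" using x body by (auto simp: convex_body_def)
  ultimately obtain a h where h: "\<And>y. y \<in> K \<Longrightarrow> (\<Sum>i<n. a i * y i) \<le> h"
    "h < (\<Sum>i<n. a i * ((- 1 / real n) *\<^sub>R x) i)"
    using separating_functional[OF convex_body_compact[OF body] _ convex_body_subset_Rn[OF body] _ _ not] by blast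
  have "- (\<Sum>i<n. a i * x i) \<le> real n * h"
    using h(1) by (rule centered_body_functional_bound[OF K n x])
  moreover have "(\<Sum>i<n. a i * ((- 1 / real n) *\<^sub>R x) i) = - (\<Sum>i<n. a i * x i) / real n"
    by (simp add: sum_divide_distrib sum_negf)
  ultimately have "real n * (\<Sum>i<n. a i * ((- 1 / real n) *\<^sub>R x) i) \<le> real n * h" using n by simp
  then show False using h(2) n by simp
qed

text \<open>K contains a cube around some x0 and also the point \<open>- x0 / n\<close>. Weights
  \<open>1 / (n + 1)\<close> and \<open>n / (n + 1)\<close> cancel x0 and leave a smaller cube
  around 0.\<close>

lemma centered_body_contains_cube:
  assumes K: "centered_convex_body n K" and n: "n \<ge> 1"
  obtains r where "r > 0" "\<forall>y\<in>Rn n. (\<forall>i<n. \<bar>y i\<bar> < r) \<longrightarrow> y \<in> K"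
proof -
  have body: "convex_body n K" and cvx: "convex K" using K by (auto simp: centered_convex_body_def convex_body_def)
  obtain x0 e where x0: "x0 \<in> K" and e: "e > 0"
    and box: "\<forall>x\<in>Rn n. (\<forall>i<n. \<bar>x i - x0 i\<bar> < e) \<longrightarrow> x \<in> K"
    using convex_body_contains_box[OF body] .
  show ?thesis
  proof (rule that[of "e / (real n + 1)"])
    show "0 < e / (real n + 1)" using e by simp
    show "\<forall>y\<in>Rn n. (\<forall>i<n. \<bar>y i\<bar> < e / (real n + 1)) \<longrightarrow> y \<in> K"
    proof (intro ballI impI)
      fix y assume y: "y \<in> Rn n" and small: "\<forall>i<n. \<bar>y i\<bar> < e / (real n + 1)"
      define v where "v = x0 + (real n + 1) *\<^sub>R y"
      have "v \<in> K"
      proof (rule box[rule_format])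
        show "v \<in> Rn n"
          unfolding v_def using x0 y convex_body_subset_Rn[OF body]
          by (intro subspace_add[OF subspace_Rn] subspace_scale[OF subspace_Rn]) auto
        show "\<bar>v i - x0 i\<bar> < e" if "i < n" for i
        proof -
          have "\<bar>v i - x0 i\<bar> = (real n + 1) * \<bar>y i\<bar>"
            using abs_mult[of "real n + 1" "y i"] by (simp add: v_def)
          also have "\<dots> < e"
            using small that by (simp add: pos_less_divide_eq mult.commute)
          finally show ?thesis .
        qed
      qed
      then have "(1 - real n / (real n + 1)) *\<^sub>R v + (real n / (real n + 1)) *\<^sub>R ((- 1 / real n) *\<^sub>R x0) \<in> K"
        using centered_body_reflection[OF K n x0] by (intro convexD_alt[OF cvx]) auto
      also have "(1 - real n / (real n + 1)) *\<^sub>R v + (real n / (real n + 1)) *\<^sub>R ((- 1 / real n) *\<^sub>R x0) = y"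
      proof
        fix i
        define m where "m = real n + 1"
        have m: "m \<noteq> 0" by (simp add: m_def)
        have 1: "1 - real n / m = 1 / m" using m by (simp add: m_def field_simps)
        have 2: "real n / m * (- 1 / real n) = - 1 / m" using n by simp
        have 3: "v i = x0 i + m * y i" by (simp add: v_def m_def)
        have "(1 / m) * (x0 i + m * y i) + (- 1 / m) * x0 i = y i" using m by (simp add: field_simps)
        then show "((1 - real n / (real n + 1)) *\<^sub>R v + (real n / (real n + 1)) *\<^sub>R ((- 1 / real n) *\<^sub>R x0)) i = y i"
          unfolding m_def[symmetric] plus_fun_apply scaleR_scaleR scaleR_fun_apply 1 2 3 real_scaleR_def .
      qed
      finally show "y \<in> K" .
    qed
  qed
qed

lemma centered_body_absorbing:
  assumes K: "centered_convex_body n K" and n: "n \<ge> 1" and y: "y \<in> Rn n"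
  shows "\<exists>t>0. y \<in> (*\<^sub>R) t ` K"
proof -
  obtain r where r: "r > 0" "\<forall>y\<in>Rn n. (\<forall>i<n. \<bar>y i\<bar> < r) \<longrightarrow> y \<in> K"
    using centered_body_contains_cube[OF K n] .
  define s where "s = (\<Sum>i<n. \<bar>y i\<bar>)"
  define t where "t = (s + 1) / r"
  have s: "s \<ge> 0" by (simp add: s_def sum_nonneg)
  have t: "t > 0" using r(1) s by (simp add: t_def)
  have "(1 / t) *\<^sub>R y \<in> K"
  proof (rule r(2)[rule_format])
    show "(1 / t) *\<^sub>R y \<in> Rn n" using y by (rule subspace_scale[OF subspace_Rn])
    fix i assume "i < n"
    then have "\<bar>y i\<bar> \<le> s" unfolding s_def by (intro member_le_sum) auto
    then have "\<bar>y i\<bar> < s + 1" by simp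
    then have "\<bar>y i\<bar> / t < (s + 1) / t" using t by (intro divide_strict_right_mono)
    also have "(s + 1) / t = r" using s r(1) by (simp add: t_def)
    finally show "\<bar>((1 / t) *\<^sub>R y) i\<bar> < r" using t by simp
  qed
  moreover have "y = t *\<^sub>R ((1 / t) *\<^sub>R y)" using t by simp
  ultimately show ?thesis using t by blast
qed

section \<open>Costs of vertices and the configuration for the upper bound\<close>

lemma minkowski_functional_le:
  assumes "0 < t" "x \<in> K"
  shows "minkowski_functional K (t *\<^sub>R x) \<le> t"
  unfolding minkowski_functional_def using assms
  by (intro cInf_lower bdd_belowI[of _ 0]) auto

lemma minkowski_functional_nonneg:
  assumes "\<exists>t>0. y \<in> (*\<^sub>R) t ` K"
  shows "0 \<le> minkowski_functional K y"
  unfolding minkowski_functional_def using assms by (intro cInf_greatest) auto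

text \<open>If all coefficients \<open>t i\<close> are at most 2 in absolute value, then \<open>\<Sum>i. t i w i\<close> is
  \<open>\<Sum>i. (t i + 2) w i - 2 \<Sum>i. w i\<close>. The first part needs vertices of cost \<open>O(n)\<close>, the second
  a single vertex, whose cost may therefore be as large as \<open>O(n\<^sup>2)\<close>.\<close>

lemma vertex_configuration:
  assumes K: "centered_convex_body n K" and n: "n \<ge> 1"
  obtains y where "\<forall>j<n + 2. y j \<in> Rn n" "K \<subseteq> convex hull (y ` {..<n + 2})"
    "(\<Sum>j<n + 2. minkowski_functional K (y j)) \<le> 13 * (real n)\<^sup>2"
proof -
  have body: "convex_body n K" and cvx: "convex K" using K by (auto simp: centered_convex_body_def convex_body_def)
  have KRn: "K \<subseteq> Rn n" using body by (rule convex_body_subset_Rn)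
  have n0: "real n > 0" "real n \<ge> 1" using n by auto
  obtain r where r: "r > 0" and cube: "\<forall>y\<in>Rn n. (\<forall>i<n. \<bar>y i\<bar> < r) \<longrightarrow> y \<in> K"
    using centered_body_contains_cube[OF K n] .
  have K0: "0 \<in> K" using subspace_0[OF subspace_Rn] r by (intro cube[rule_format]) auto
  obtain R where "R > 0" and R: "\<forall>x\<in>K. \<forall>i. \<bar>x i\<bar> \<le> R" using convex_body_bounded[OF body] .
  have rK: "\<forall>i<n. (r / 2) *\<^sub>R unit_vec i \<in> K"
  proof (intro allI impI)
    fix i assume "i < n"
    then have "(r / 2) *\<^sub>R unit_vec i \<in> Rn n"
      by (rule subspace_scale[OF subspace_Rn unit_vec_in_Rn])
    moreover have "\<forall>k<n. \<bar>((r / 2) *\<^sub>R unit_vec i) k\<bar> < r" using r by simp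
    ultimately show "(r / 2) *\<^sub>R unit_vec i \<in> K" using cube by blast
  qed
  have r2: "0 < r / 2" using r by simp
  obtain w where "\<forall>i<n. w i \<in> K"
    and coeff: "\<forall>x\<in>K. \<exists>t. x = (\<Sum>i<n. t i *\<^sub>R w i) \<and> (\<forall>i<n. \<bar>t i\<bar> \<le> 2)"
    using bounded_coefficients_basis[OF KRn R r2 rK] .
  then have w: "\<And>i. i < n \<Longrightarrow> w i \<in> K" by blast
  define W where "W = (\<Sum>i<n. w i)"
  \<comment> \<open>The shifted coefficients lie between 0 and 4, so dividing them by
    \<open>8 * n\<close> gives weights of sum at most 1/2. The point \<open>- 4 * W\<close> gets
    weight 1/2 and supplies the correction \<open>- 2 * W\<close>; the vertex 0 takes the remaining
    weight.\<close>
  define y where "y = (\<lambda>j. if j < n then (8 * real n) *\<^sub>R w j else if j = n then (- 4) *\<^sub>R W else 0)"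
  have WRn: "W \<in> Rn n" unfolding W_def using w KRn by (intro subspace_sum[OF subspace_Rn]) auto
  have y_simps: "\<And>j. j < n \<Longrightarrow> y j = (8 * real n) *\<^sub>R w j" "y n = (- 4) *\<^sub>R W" "y (Suc n) = 0"
    by (simp_all add: y_def del: scaleR_fun_apply)
  show ?thesis
  proof (rule that[of y], intro allI impI)
    fix j assume "j < n + 2"
    then consider "j < n" | "j = n" | "j = Suc n" by linarith
    then show "y j \<in> Rn n"
    proof cases
      case 1
      then show ?thesis unfolding y_simps(1)[OF 1] using w KRn by (intro subspace_scale[OF subspace_Rn]) auto
    next
      case 2
      show ?thesis unfolding 2 y_simps(2) by (rule subspace_scale[OF subspace_Rn WRn])
    next
      case 3
      show ?thesis unfolding 3 y_simps(3) by (rule subspace_0[OF subspace_Rn])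
    qed
  next
    show "K \<subseteq> convex hull (y ` {..<n + 2})"
    proof
      fix x assume "x \<in> K"
      then obtain t where t: "x = (\<Sum>i<n. t i *\<^sub>R w i)" "\<And>i. i < n \<Longrightarrow> \<bar>t i\<bar> \<le> 2" using coeff by blast
      define \<sigma> where "\<sigma> = (\<Sum>i<n. (t i + 2) / (8 * real n))"
      define u where "u = (\<lambda>j. if j < n then (t j + 2) / (8 * real n) else if j = n then 1 / 2 else 1 / 2 - \<sigma>)"
      have u_simps: "\<And>j. j < n \<Longrightarrow> u j = (t j + 2) / (8 * real n)" "u n = 1 / 2" "u (Suc n) = 1 / 2 - \<sigma>"
        by (simp_all add: u_def)
      have t_bd: "0 \<le> t i + 2" "t i + 2 \<le> 4" if "i < n" for i using t(2)[OF that] by (auto simp: abs_le_iff)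
      have "\<sigma> \<le> (\<Sum>i<n. 4 / (8 * real n))"
        unfolding \<sigma>_def using t_bd n0 by (intro sum_mono divide_right_mono) auto
      also have "\<dots> = 1 / 2" using n0 by simp
      finally have \<sigma>: "\<sigma> \<le> 1 / 2" .
      have idx: "{..<n + 2} = insert (Suc n) (insert n {..<n})" by auto
      have "(\<Sum>j<n. u j) = \<sigma>" unfolding \<sigma>_def by (intro sum.cong) (auto simp: u_simps)
      then have "(\<Sum>j<n + 2. u j) = 1" unfolding idx by (simp add: u_simps)
      moreover have "0 \<le> u j" if "j \<in> {..<n + 2}" for j
        using t_bd n0 \<sigma> by (auto simp: u_def)
      moreover have "y j \<in> convex hull (y ` {..<n + 2})" if "j \<in> {..<n + 2}" for j
        using that by (intro hull_inc imageI)
      ultimately have "(\<Sum>j<n + 2. u j *\<^sub>R y j) \<in> convex hull (y ` {..<n + 2})"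
        by (intro convex_sum convex_convex_hull) auto
      also have "(\<Sum>j<n + 2. u j *\<^sub>R y j) = x"
      proof -
        have "(\<Sum>j<n + 2. u j *\<^sub>R y j) = (\<Sum>j<n. u j *\<^sub>R y j) + (1 / 2) *\<^sub>R ((- 4) *\<^sub>R W)"
          unfolding idx by (simp add: u_simps y_simps del: scaleR_fun_apply sum_fun_apply)
        also have "(\<Sum>j<n. u j *\<^sub>R y j) = (\<Sum>j<n. t j *\<^sub>R w j + 2 *\<^sub>R w j)"
          using n0 by (intro sum.cong refl)
            (simp add: u_simps y_simps scaleR_left_distrib[symmetric] del: scaleR_fun_apply)
        also have "\<dots> = x + 2 *\<^sub>R W"
          by (simp only: sum.distrib t(1) W_def scaleR_sum_right)
        also have "x + 2 *\<^sub>R W + (1 / 2) *\<^sub>R ((- 4) *\<^sub>R W) = x"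
          by (simp add: fun_eq_iff)
        finally show ?thesis .
      qed
      finally show "x \<in> convex hull (y ` {..<n + 2})" .
    qed
  next
    have "minkowski_functional K (y j) \<le> 8 * real n" if "j < n" for j
      unfolding y_simps(1)[OF that] using n0 w[OF that] by (intro minkowski_functional_le) auto
    then have 1: "(\<Sum>j<n. minkowski_functional K (y j)) \<le> (\<Sum>j<n. 8 * real n)" by (intro sum_mono) auto
    \<comment> \<open>The average of the \<open>w i\<close> lies in K, hence
      \<open>- W / n^2\<close> does too, and \<open>- 4 * W\<close> costs at most
      \<open>4 * n^2\<close>.\<close>
    have "(\<Sum>i<n. (1 / real n) *\<^sub>R w i) \<in> K"
      using w n0 by (intro convex_sum[OF _ cvx]) auto
    then have "(1 / real n) *\<^sub>R W \<in> K" by (simp only: W_def scaleR_sum_right)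
    then have "(- 1 / real n) *\<^sub>R ((1 / real n) *\<^sub>R W) \<in> K"
      by (rule centered_body_reflection[OF K n])
    then have "minkowski_functional K ((4 * (real n)\<^sup>2) *\<^sub>R ((- 1 / real n) *\<^sub>R ((1 / real n) *\<^sub>R W))) \<le> 4 * (real n)\<^sup>2"
      using n0 by (intro minkowski_functional_le) auto
    also have "(4 * (real n)\<^sup>2) *\<^sub>R ((- 1 / real n) *\<^sub>R ((1 / real n) *\<^sub>R W)) = y n"
      unfolding y_simps scaleR_scaleR using n0 by (simp add: power2_eq_square del: scaleR_fun_apply)
    finally have 2: "minkowski_functional K (y n) \<le> 4 * (real n)\<^sup>2" .
    have 3: "minkowski_functional K (y (Suc n)) \<le> 1"
      using minkowski_functional_le[of 1 0 K] K0 by (simp add: y_simps)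
    \<comment> \<open>The total is \<open>8 * n^2 + 4 * n^2 + 1\<close>.\<close>
    have "1 \<le> (real n)\<^sup>2" using n0 by simp
    then show "(\<Sum>j<n + 2. minkowski_functional K (y j)) \<le> 13 * (real n)\<^sup>2"
      using 1 2 3 by (simp add: power2_eq_square)
  qed
qed

section \<open>Circumscribed ellipsoids and passage to the infima\<close>

lemma convex_unit_ball: "convex (unit_ball n)"
proof (rule convexI)
  fix x y and u v :: real
  assume x: "x \<in> unit_ball n" and y: "y \<in> unit_ball n" and uv: "0 \<le> u" "0 \<le> v" "u + v = 1"
  have "u *\<^sub>R x + v *\<^sub>R y \<in> Rn n"
    using x y unfolding unit_ball_iff
    by (intro subspace_add[OF subspace_Rn] subspace_scale[OF subspace_Rn]) auto
  moreover have "L2_set (u *\<^sub>R x + v *\<^sub>R y) {..<n} \<le> 1"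
  proof -
    have "L2_set (u *\<^sub>R x + v *\<^sub>R y) {..<n} \<le> L2_set (u *\<^sub>R x) {..<n} + L2_set (v *\<^sub>R y) {..<n}"
      unfolding plus_fun_def by (rule L2_set_triangle_ineq)
    also have "\<dots> \<le> u * 1 + v * 1"
      unfolding L2_set_fun_scaleR using x y uv
      by (intro add_mono mult_mono) (auto simp: unit_ball_iff)
    finally show ?thesis using uv(3) by simp
  qed
  ultimately show "u *\<^sub>R x + v *\<^sub>R y \<in> unit_ball n" by (simp only: unit_ball_iff)
qed

text \<open>A large ball suffices; it makes the infimum in the outer volume ratio one over a
  nonempty set.\<close>

lemma convex_body_in_ellipsoid:
  assumes body: "convex_body n K" and n: "n \<ge> 1"
  shows "\<exists>E. ellipsoid n E \<and> convex hull (K \<union> uminus ` K) \<subseteq> E"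
proof -
  obtain R where R: "R > 0" and bd: "\<forall>x\<in>K. \<forall>i. \<bar>x i\<bar> \<le> R" using convex_body_bounded[OF body] .
  define \<rho> where "\<rho> = R * real n"
  have \<rho>: "\<rho> > 0" using R n by (simp add: \<rho>_def)
  define T where "T = (\<lambda>x :: nat \<Rightarrow> real. \<rho> *\<^sub>R x)"
  define E where "E = (\<lambda>x. 0 + T x) ` unit_ball n"
  have "linear T" unfolding T_def by (rule linearI) (simp_all add: fun_eq_iff algebra_simps)
  moreover have "bij_betw T (Rn n) (Rn n)"
  proof (rule bij_betwI[where g = "\<lambda>x. (1 / \<rho>) *\<^sub>R x"])
    show "T \<in> Rn n \<rightarrow> Rn n" "(\<lambda>x. (1 / \<rho>) *\<^sub>R x) \<in> Rn n \<rightarrow> Rn n"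
      unfolding T_def using subspace_scale[OF subspace_Rn] by blast+
  qed (use \<rho> in \<open>simp_all add: T_def\<close>)
  ultimately have ell: "ellipsoid n E"
    unfolding ellipsoid_def E_def using subspace_0[OF subspace_Rn] by blast
  have ball: "(1 / \<rho>) *\<^sub>R x \<in> unit_ball n" if "x \<in> K" for x
  proof -
    have "(((1 / \<rho>) *\<^sub>R x) i)\<^sup>2 \<le> 1 / real n" for i
    proof -
      have "\<bar>((1 / \<rho>) *\<^sub>R x) i\<bar> \<le> R / \<rho>" using bd that \<rho> by (simp add: divide_right_mono)
      also have "\<dots> = 1 / real n" using R by (simp add: \<rho>_def)
      finally have "\<bar>((1 / \<rho>) *\<^sub>R x) i\<bar>\<^sup>2 \<le> (1 / real n)\<^sup>2" by (intro power_mono) auto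
      also have "\<dots> \<le> 1 / real n" using n by (simp add: power2_eq_square field_simps)
      finally show ?thesis by (simp only: power2_abs)
    qed
    then have "(\<Sum>i<n. (((1 / \<rho>) *\<^sub>R x) i)\<^sup>2) \<le> (\<Sum>i<n. 1 / real n)" by (intro sum_mono)
    also have "\<dots> = 1" using n by simp
    finally have "(\<Sum>i<n. (((1 / \<rho>) *\<^sub>R x) i)\<^sup>2) \<le> 1" .
    moreover have "(1 / \<rho>) *\<^sub>R x \<in> Rn n"
      using convex_body_subset_Rn[OF body] that subspace_scale[OF subspace_Rn] by blast
    ultimately show ?thesis unfolding unit_ball_def by blast
  qed
  have "K \<union> uminus ` K \<subseteq> E"
  proof -
    have "x \<in> E" "- x \<in> E" if x: "x \<in> K" for x
    proof -
      have "x = 0 + T ((1 / \<rho>) *\<^sub>R x)" "- x = 0 + T (- ((1 / \<rho>) *\<^sub>R x))"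
        using \<rho> by (simp_all add: T_def fun_eq_iff)
      moreover have "- ((1 / \<rho>) *\<^sub>R x) \<in> unit_ball n"
        using ball[OF x] unit_ball_uminus by blast
      ultimately show "x \<in> E" "- x \<in> E" unfolding E_def using ball[OF x] by blast+
    qed
    then show ?thesis by blast
  qed
  moreover have "convex E"
    unfolding E_def T_def add_0_left by (rule convex_scaling[OF convex_unit_ball])
  ultimately have "convex hull (K \<union> uminus ` K) \<subseteq> E" by (rule hull_minimal)
  with ell show ?thesis by blast
qed

lemma vertex_index_lower_bound:
  fixes y :: "nat \<Rightarrow> nat \<Rightarrow> real"
  assumes K: "centered_convex_body n K" and n: "n \<ge> 1"
    and y: "\<And>j. j < N \<Longrightarrow> y j \<in> Rn n" and hull: "K \<subseteq> convex hull (y ` {..<N})"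
  shows "exp (- 2) * real n powr (3 / 2) / outer_volume_ratio n (convex hull (K \<union> uminus ` K))
    \<le> (\<Sum>j<N. minkowski_functional K (y j))"
proof -
  define L where "L = convex hull (K \<union> uminus ` K)"
  define s where "s = (\<Sum>j<N. minkowski_functional K (y j))"
  define c where "c = exp (- 2) * real n powr (3 / 2)"
  define D where "D = {(vol n E / vol n L) powr (1 / real n) | E. ellipsoid n E \<and> L \<subseteq> E}"
  have ovr: "outer_volume_ratio n L = Inf D" by (simp add: outer_volume_ratio_def D_def)
  have body: "convex_body n K" using K by (simp add: centered_convex_body_def)
  have absorb: "\<And>v. v \<in> Rn n \<Longrightarrow> \<exists>t>0. v \<in> (*\<^sub>R) t ` K" using K n by (rule centered_body_absorbing)
  have c0: "c \<ge> 0" by (simp add: c_def)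
  have s0: "s \<ge> 0" unfolding s_def
    by (rule sum_nonneg) (use absorb y in \<open>auto intro: minkowski_functional_nonneg\<close>)
  have ne: "D \<noteq> {}" using convex_body_in_ellipsoid[OF body n] unfolding D_def L_def by blast
  have bdd: "bdd_below D" by (rule bdd_belowI[of _ 0]) (auto simp: D_def)
  have "c / Inf D \<le> s"
  \<comment> \<open>If the ratio is not positive, the quotient is at most 0, division by 0 being 0,
    and the bound is trivial.\<close>
  proof (cases "Inf D \<le> 0")
    case True
    then have "c / Inf D \<le> 0" using c0 by (simp add: divide_nonneg_nonpos)
    then show ?thesis using s0 by simp
  next
    case False
    then have D0: "Inf D > 0" by simp
    \<comment> \<open>Volume 0 would turn every quotient of volumes into 0 and hence the ratio as
      well.\<close>
    have L0: "vol n L > 0"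
    proof (rule ccontr)
      assume "\<not> vol n L > 0"
      then have "vol n L = 0" by (simp add: vol_def less_le)
      then have "D \<subseteq> {0}" by (auto simp: D_def)
      then have "D = {0}" using ne by blast
      then show False using D0 by simp
    qed
    have KRn: "K \<subseteq> Rn n" using body by (rule convex_body_subset_Rn)
    have each: "s > 0 \<and> c / s \<le> d" if d: "d \<in> D" for d
    proof -
      obtain E where E: "ellipsoid n E" "convex hull (K \<union> uminus ` K) \<subseteq> E"
        and d: "d = (vol n E / vol n L) powr (1 / real n)"
        using d unfolding D_def L_def by blast
      note bound = vertex_sum_ellipsoid_bound[OF n KRn absorb E L0[unfolded L_def] y hull]
      show ?thesis unfolding d c_def s_def L_def using bound by blast
    qed
    then have s_pos: "s > 0" using ne by blast
    have "c / s \<le> Inf D" using each by (intro cInf_greatest[OF ne]) blast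
    then show ?thesis using s_pos D0 by (simp add: field_simps)
  qed
  then show ?thesis by (simp add: ovr[symmetric] c_def s_def L_def)
qed

theorem theorem1p2:
  shows "\<exists>c\<^sub>1 c\<^sub>2 :: real. c\<^sub>1 > 0 \<and> c\<^sub>2 > 0 \<and>
    (\<forall>n\<ge>2. \<forall>K. centered_convex_body n K \<longrightarrow>
      c\<^sub>1 * real n powr (3 / 2) / outer_volume_ratio n (convex hull (K \<union> uminus ` K)) \<le> vertex_index n K \<and>
      vertex_index n K \<le> c\<^sub>2 * (real n)\<^sup>2)"
\<comment> \<open>The constants come from the two factorial estimates and from the cost of the
  explicit configuration.\<close>
proof (rule exI[of _ "exp (- 2)"], rule exI[of _ 13], intro conjI allI impI)
  fix n :: nat and K
  assume n2: "2 \<le> n" and K: "centered_convex_body n K"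
  then have n: "n \<ge> 1" by simp
  define D where "D = {\<Sum>j<N. minkowski_functional K (y j) | (N::nat) (y :: nat \<Rightarrow> nat \<Rightarrow> real).
      N \<ge> 1 \<and> (\<forall>j<N. y j \<in> Rn n) \<and> K \<subseteq> convex hull (y ` {..<N})}"
  have vi: "vertex_index n K = Inf D" by (simp only: vertex_index_def D_def)
  obtain y where y: "\<forall>j<n + 2. y j \<in> Rn n" "K \<subseteq> convex hull (y ` {..<n + 2})"
    "(\<Sum>j<n + 2. minkowski_functional K (y j)) \<le> 13 * (real n)\<^sup>2"
    using vertex_configuration[OF K n] .
  have mem: "(\<Sum>j<n + 2. minkowski_functional K (y j)) \<in> D"
    unfolding D_def using y(1,2) by (intro CollectI exI[of _ "n + 2"] exI[of _ y]) simp
  have "bdd_below D"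
  proof (rule bdd_belowI[of _ 0])
    fix s assume "s \<in> D"
    then obtain N :: nat and z where "s = (\<Sum>j<N. minkowski_functional K (z j))" "\<forall>j<N. z j \<in> Rn n"
      unfolding D_def by blast
    then show "0 \<le> s"
      using centered_body_absorbing[OF K n] by (auto intro!: sum_nonneg minkowski_functional_nonneg)
  qed
  then have "Inf D \<le> (\<Sum>j<n + 2. minkowski_functional K (y j))" using mem by (rule cInf_lower[rotated])
  then show "vertex_index n K \<le> 13 * (real n)\<^sup>2" unfolding vi using y(3) by (rule order_trans)
  show "exp (- 2) * real n powr (3 / 2) / outer_volume_ratio n (convex hull (K \<union> uminus ` K)) \<le> vertex_index n K"
    unfolding vi
  proof (rule cInf_greatest)
    show "D \<noteq> {}" using mem by blast
    fix s assume "s \<in> D"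
    then obtain N :: nat and z where "s = (\<Sum>j<N. minkowski_functional K (z j))" "\<forall>j<N. z j \<in> Rn n"
      "K \<subseteq> convex hull (z ` {..<N})"
      unfolding D_def by blast
    then show "exp (- 2) * real n powr (3 / 2) / outer_volume_ratio n (convex hull (K \<union> uminus ` K)) \<le> s"
      using vertex_index_lower_bound[OF K n, of N z] by simp
  qed
qed simp_all

end
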